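(* Let $(\mathcal{A}',\mathcal{A},\mathcal{A}'',i^*,i_*,i^!,j_!,j^*,j_* )$ be a recollement of abelian categories, with intermediate extension functor $j_{!*}:\mathcal{A}''\to\mathcal{A}$. Then the following hold. (1) Both $i_*$ and $j_{!*}$ preserve epibricks and monobricks; that is, $i_*$ sends epibricks (resp. monobricks) in $\mathcal{A}'$ to epibricks (resp. monobricks) in $\mathcal{A}$, and $j_{!*}$ sends epibricks (resp. monobricks) in $\mathcal{A}''$ to epibricks (resp. monobricks) in $\mathcal{A}$. (2) $j_*$ sends monobricks in $\mathcal{A}''$ to monobricks in $\mathcal{A}$, and $j_!$ sends epibricks in $\mathcal{A}''$ to epibricks in $\mathcal{A}$. (3) If $\mathcal{C}'$ is an epibrick in $\mathcal{A}'$ and $\mathcal{C}''$ is an epibrick in $\mathcal{A}''$, then $i_*(\mathcal{C}')\cup j_{!*}(\mathcal{C}'')$ is an epibrick in $\mathcal{A}$. Likewise, if $\mathcal{C}'$ and $\mathcal{C}''$ are monobricks in $\mathcal{A}'$ and $\mathcal{A}''$, then $i_*(\mathcal{C}')\cup j_{!*}(\mathcal{C}'')$ is a monobrick in $\mathcal{A}$. (4) Let $\mathcal{C}'$ be an epibrick in $\mathcal{A}'$ and $\mathcal{C}''$ an epibrick in $\mathcal{A}''$. If $i^*$ is exact, then $i_*(\mathcal{C}')\cup j_!(\mathcal{C}'')$ is an epibrick in $\mathcal{A}$; if $i^!$ is exact, then $i_*(\mathcal{C}')\cup j_*(\mathcal{C}'')$ is an epibrick in $\mathcal{A}$. The same statements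 hold with "epibrick" replaced by "monobrick" throughout.
   Context: All functors between abelian categories are additive. A recollement $(\mathcal{A}',\mathcal{A},\mathcal{A}'',i^*,i_*,i^!,j_!,j^*,j_* )$ of abelian categories consists of abelian categories $\mathcal{A}',\mathcal{A},\mathcal{A}''$ and functors $i_*:\mathcal{A}'\to\mathcal{A}$, $i^*,i^!:\mathcal{A}\to\mathcal{A}'$, $j^*:\mathcal{A}\to\mathcal{A}''$, $j_!,j_*:\mathcal{A}''\to\mathcal{A}$ such that: (i) $(i^*,i_* )$, $(i_*,i^!)$, $(j_!,j^* )$, $(j^*,j_* )$ are adjoint pairs (left adjoint first); (ii) $i_*$, $j_!$, $j_*$ are fully faithful; (iii) the full subcategory $\mathrm{Ker}\,j^*$ of objects killed by $j^*$ equals the essential image of $i_*$. The intermediate extension functor $j_{!*}:\mathcal{A}''\to\mathcal{A}$ is given by $j_{!*}(M)=\mathrm{Im}(\gamma_M:j_!M\to j_*M)$, where $\gamma_M$ corresponds to $\mathrm{id}_M$ under the natural isomorphisms $\mathrm{Hom}_{\mathcal{A}}(j_!M,j_*M)\cong\mathrm{Hom}_{\mathcal{A}''}(M,j^*j_*M)\cong\mathrm{Hom}_{\mathcal{A}''}(M,M)$ (the second via the counit $j^*j_*\cong\mathrm{Id}$). An object $A$ of an abelian category is a brick if $\mathrm{End}(A)$ is a division ring. An epibrick (resp. monobrick) in an abelian category is a set $S$ of (isomorphism classes of) bricks such that every morphism between elements of $S$ is either zero or an epimorphism (resp. a monomorphism). For a functor $F$ and a set $S$ of isomorphism classes of objects,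 $F(S)$ is the set of isomorphism classes of $F(C)$, $C\in S$. *)

theory Defs
  imports "HOL-Algebra.Ring"
begin

section \<open>Categories and abelian categories\<close>

record ('o, 'm) cat =
  Obj :: "'o set"
  Arr :: "'m set"
  Dom :: "'m \<Rightarrow> 'o"
  Cod :: "'m \<Rightarrow> 'o"
  Ident :: "'o \<Rightarrow> 'm"
  Comp :: "'m \<Rightarrow> 'm \<Rightarrow> 'm"  (infixl "\<cdot>\<index>" 70)

record ('o, 'm) preadd_cat = "('o, 'm) cat" +
  ZeroArr :: "'o \<Rightarrow> 'o \<Rightarrow> 'm"
  AddArr :: "'m \<Rightarrow> 'm \<Rightarrow> 'm"

definition homset :: "('o, 'm, 'z) cat_scheme \<Rightarrow> 'o \<Rightarrow> 'o \<Rightarrow> 'm set" where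
  "homset C X Y = {f \<in> Arr C. Dom C f = X \<and> Cod C f = Y}"

locale category =
  fixes C :: "('o, 'm, 'z) cat_scheme" (structure)
  assumes Dom_Obj: "f \<in> Arr C \<Longrightarrow> Dom C f \<in> Obj C"
    and Cod_Obj: "f \<in> Arr C \<Longrightarrow> Cod C f \<in> Obj C"
    and Ident_hom: "X \<in> Obj C \<Longrightarrow> Ident C X \<in> homset C X X"
    and Comp_hom: "\<lbrakk>f \<in> homset C X Y; g \<in> homset C Y Z\<rbrakk> \<Longrightarrow> g \<cdot> f \<in> homset C X Z"
    and Comp_Ident: "f \<in> homset C X Y \<Longrightarrow> f \<cdot> Ident C X = f"
    and Ident_Comp: "f \<in> homset C X Y \<Longrightarrow> Ident C Y \<cdot> f = f"
    and Comp_assoc: "\<lbrakk>f \<in> homset C X Y; g \<in> homset C Y Z; h \<in> homset C Z W\<rbrakk>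
      \<Longrightarrow> (h \<cdot> g) \<cdot> f = h \<cdot> (g \<cdot> f)"

definition mono_arr :: "('o, 'm, 'z) cat_scheme \<Rightarrow> 'm \<Rightarrow> bool" where
  "mono_arr C f \<longleftrightarrow> f \<in> Arr C \<and>
    (\<forall>X. \<forall>g \<in> homset C X (Dom C f). \<forall>h \<in> homset C X (Dom C f).
      f \<cdot>\<^bsub>C\<^esub> g = f \<cdot>\<^bsub>C\<^esub> h \<longrightarrow> g = h)"

definition epi_arr :: "('o, 'm, 'z) cat_scheme \<Rightarrow> 'm \<Rightarrow> bool" where
  "epi_arr C f \<longleftrightarrow> f \<in> Arr C \<and>
    (\<forall>X. \<forall>g \<in> homset C (Cod C f) X. \<forall>h \<in> homset C (Cod C f) X.
      g \<cdot>\<^bsub>C\<^esub> f = h \<cdot>\<^bsub>C\<^esub> f \<longrightarrow> g = h)"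

definition isomorphic :: "('o, 'm, 'z) cat_scheme \<Rightarrow> 'o \<Rightarrow> 'o \<Rightarrow> bool" where
  "isomorphic C X Y \<longleftrightarrow> X \<in> Obj C \<and> Y \<in> Obj C \<and>
    (\<exists>f \<in> homset C X Y. \<exists>g \<in> homset C Y X.
      g \<cdot>\<^bsub>C\<^esub> f = Ident C X \<and> f \<cdot>\<^bsub>C\<^esub> g = Ident C Y)"

definition hom_group :: "('o, 'm, 'z) preadd_cat_scheme \<Rightarrow> 'o \<Rightarrow> 'o \<Rightarrow> 'm monoid" where
  "hom_group C X Y = \<lparr>carrier = homset C X Y, mult = AddArr C, one = ZeroArr C X Y\<rparr>"

definition zero_object :: "('o, 'm, 'z) cat_scheme \<Rightarrow> 'o \<Rightarrow> bool" where
  "zero_object C Z \<longleftrightarrow> Z \<in> Obj C \<and>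
    (\<forall>X \<in> Obj C. (\<exists>!f. f \<in> homset C Z X) \<and> (\<exists>!f. f \<in> homset C X Z))"

definition biproduct ::
    "('o, 'm, 'z) preadd_cat_scheme \<Rightarrow> 'o \<Rightarrow> 'o \<Rightarrow> 'o \<Rightarrow> 'm \<Rightarrow> 'm \<Rightarrow> 'm \<Rightarrow> 'm \<Rightarrow> bool" where
  "biproduct C X Y P i1 i2 p1 p2 \<longleftrightarrow>
    i1 \<in> homset C X P \<and> i2 \<in> homset C Y P \<and> p1 \<in> homset C P X \<and> p2 \<in> homset C P Y \<and>
    p1 \<cdot>\<^bsub>C\<^esub> i1 = Ident C X \<and> p2 \<cdot>\<^bsub>C\<^esub> i2 = Ident C Y \<and>
    p2 \<cdot>\<^bsub>C\<^esub> i1 = ZeroArr C X Y \<and> p1 \<cdot>\<^bsub>C\<^esub> i2 = ZeroArr C Y X \<and>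
    AddArr C (i1 \<cdot>\<^bsub>C\<^esub> p1) (i2 \<cdot>\<^bsub>C\<^esub> p2) = Ident C P"

definition is_kernel :: "('o, 'm, 'z) preadd_cat_scheme \<Rightarrow> 'm \<Rightarrow> 'm \<Rightarrow> bool" where
  "is_kernel C f k \<longleftrightarrow> f \<in> Arr C \<and> k \<in> Arr C \<and> Cod C k = Dom C f \<and>
    f \<cdot>\<^bsub>C\<^esub> k = ZeroArr C (Dom C k) (Cod C f) \<and>
    (\<forall>X. \<forall>h \<in> homset C X (Dom C f). f \<cdot>\<^bsub>C\<^esub> h = ZeroArr C X (Cod C f) \<longrightarrow>
      (\<exists>!u. u \<in> homset C X (Dom C k) \<and> k \<cdot>\<^bsub>C\<^esub> u = h))"

definition is_cokernel :: "('o, 'm, 'z) preadd_cat_scheme \<Rightarrow> 'm \<Rightarrow> 'm \<Rightarrow> bool" where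
  "is_cokernel C f c \<longleftrightarrow> f \<in> Arr C \<and> c \<in> Arr C \<and> Dom C c = Cod C f \<and>
    c \<cdot>\<^bsub>C\<^esub> f = ZeroArr C (Dom C f) (Cod C c) \<and>
    (\<forall>X. \<forall>h \<in> homset C (Cod C f) X. h \<cdot>\<^bsub>C\<^esub> f = ZeroArr C (Dom C f) X \<longrightarrow>
      (\<exists>!u. u \<in> homset C (Cod C c) X \<and> u \<cdot>\<^bsub>C\<^esub> c = h))"

locale preadditive_category = category C
  for C :: "('o, 'm, 'z) preadd_cat_scheme" (structure) +
  assumes hom_comm_group: "\<lbrakk>X \<in> Obj C; Y \<in> Obj C\<rbrakk> \<Longrightarrow> comm_group (hom_group C X Y)"
    and Comp_Add: "\<lbrakk>f \<in> homset C X Y; g \<in> homset C Y Z; h \<in> homset C Y Z\<rbrakk>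
      \<Longrightarrow> AddArr C g h \<cdot> f = AddArr C (g \<cdot> f) (h \<cdot> f)"
    and Add_Comp: "\<lbrakk>f \<in> homset C X Y; g \<in> homset C X Y; h \<in> homset C Y Z\<rbrakk>
      \<Longrightarrow> h \<cdot> AddArr C f g = AddArr C (h \<cdot> f) (h \<cdot> g)"

locale abelian_category = preadditive_category +
  assumes ex_zero_object: "\<exists>Z. zero_object C Z"
    and ex_biproduct: "\<lbrakk>X \<in> Obj C; Y \<in> Obj C\<rbrakk> \<Longrightarrow> \<exists>P i1 i2 p1 p2. biproduct C X Y P i1 i2 p1 p2"
    and ex_kernel: "f \<in> Arr C \<Longrightarrow> \<exists>k. is_kernel C f k"
    and ex_cokernel: "f \<in> Arr C \<Longrightarrow> \<exists>c. is_cokernel C f c"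
    and mono_is_kernel: "mono_arr C f \<Longrightarrow> \<exists>g. is_kernel C g f"
    and epi_is_cokernel: "epi_arr C f \<Longrightarrow> \<exists>g. is_cokernel C g f"

text \<open>The image of an arrow is given by its inclusion, a kernel of a cokernel.\<close>

definition is_image :: "('o, 'm, 'z) preadd_cat_scheme \<Rightarrow> 'm \<Rightarrow> 'm \<Rightarrow> bool" where
  "is_image C f m \<longleftrightarrow> (\<exists>c. is_cokernel C f c \<and> is_kernel C c m)"

definition im_incl :: "('o, 'm, 'z) preadd_cat_scheme \<Rightarrow> 'm \<Rightarrow> 'm" where
  "im_incl C f = (SOME m. is_image C f m)"

definition im_obj :: "('o, 'm, 'z) preadd_cat_scheme \<Rightarrow> 'm \<Rightarrow> 'o" where
  "im_obj C f = Dom C (im_incl C f)"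

definition short_exact :: "('o, 'm, 'z) preadd_cat_scheme \<Rightarrow> 'm \<Rightarrow> 'm \<Rightarrow> bool" where
  "short_exact C f g \<longleftrightarrow> mono_arr C f \<and> epi_arr C g \<and> (\<exists>m. is_image C f m \<and> is_kernel C g m)"


section \<open>Functors and adjunctions\<close>

record ('o1, 'm1, 'o2, 'm2) ftr =
  FObj :: "'o1 \<Rightarrow> 'o2"
  FArr :: "'m1 \<Rightarrow> 'm2"

locale additive_functor =
  fixes C :: "('o1, 'm1, 'z1) preadd_cat_scheme"
    and D :: "('o2, 'm2, 'z2) preadd_cat_scheme"
    and F :: "('o1, 'm1, 'o2, 'm2) ftr"
  assumes FObj_Obj: "X \<in> Obj C \<Longrightarrow> FObj F X \<in> Obj D"
    and FArr_hom: "f \<in> homset C X Y \<Longrightarrow> FArr F f \<in> homset D (FObj F X) (FObj F Y)"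
    and FArr_Ident: "X \<in> Obj C \<Longrightarrow> FArr F (Ident C X) = Ident D (FObj F X)"
    and FArr_Comp: "\<lbrakk>f \<in> homset C X Y; g \<in> homset C Y Z\<rbrakk>
      \<Longrightarrow> FArr F (g \<cdot>\<^bsub>C\<^esub> f) = FArr F g \<cdot>\<^bsub>D\<^esub> FArr F f"
    and FArr_Add: "\<lbrakk>f \<in> homset C X Y; g \<in> homset C X Y\<rbrakk>
      \<Longrightarrow> FArr F (AddArr C f g) = AddArr D (FArr F f) (FArr F g)"

definition exact_functor ::
    "('o1, 'm1, 'z1) preadd_cat_scheme \<Rightarrow> ('o2, 'm2, 'z2) preadd_cat_scheme
      \<Rightarrow> ('o1, 'm1, 'o2, 'm2) ftr \<Rightarrow> bool" where
  "exact_functor C D F \<longleftrightarrow> additive_functor C D F \<and>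
    (\<forall>f g. short_exact C f g \<longrightarrow> short_exact D (FArr F f) (FArr F g))"

definition fully_faithful ::
    "('o1, 'm1, 'z1) cat_scheme \<Rightarrow> ('o2, 'm2, 'z2) cat_scheme
      \<Rightarrow> ('o1, 'm1, 'o2, 'm2) ftr \<Rightarrow> bool" where
  "fully_faithful C D F \<longleftrightarrow>
    (\<forall>X \<in> Obj C. \<forall>Y \<in> Obj C. bij_betw (FArr F) (homset C X Y) (homset D (FObj F X) (FObj F Y)))"

definition ess_image ::
    "('o1, 'm1, 'z1) cat_scheme \<Rightarrow> ('o2, 'm2, 'z2) cat_scheme
      \<Rightarrow> ('o1, 'm1, 'o2, 'm2) ftr \<Rightarrow> 'o2 set" where
  "ess_image C D F = {Y \<in> Obj D. \<exists>X \<in> Obj C. isomorphic D (FObj F X) Y}"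

definition Ker_obj ::
    "('o1, 'm1, 'z1) cat_scheme \<Rightarrow> ('o2, 'm2, 'z2) cat_scheme
      \<Rightarrow> ('o1, 'm1, 'o2, 'm2) ftr \<Rightarrow> 'o1 set" where
  "Ker_obj C D F = {X \<in> Obj C. zero_object D (FObj F X)}"

text \<open>\<open>\<phi> X Y : Hom\<^sub>D(L X, Y) \<rightarrow> Hom\<^sub>C(X, R Y)\<close> is a natural bijection,
  for \<open>L : C \<rightarrow> D\<close> left adjoint to \<open>R : D \<rightarrow> C\<close>.\<close>

definition adjunction ::
    "('o1, 'm1, 'z1) cat_scheme \<Rightarrow> ('o2, 'm2, 'z2) cat_scheme
      \<Rightarrow> ('o1, 'm1, 'o2, 'm2) ftr \<Rightarrow> ('o2, 'm2, 'o1, 'm1) ftr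
      \<Rightarrow> ('o1 \<Rightarrow> 'o2 \<Rightarrow> 'm2 \<Rightarrow> 'm1) \<Rightarrow> bool" where
  "adjunction C D L R \<phi> \<longleftrightarrow>
    (\<forall>X \<in> Obj C. \<forall>Y \<in> Obj D.
      bij_betw (\<phi> X Y) (homset D (FObj L X) Y) (homset C X (FObj R Y))) \<and>
    (\<forall>X \<in> Obj C. \<forall>X' \<in> Obj C. \<forall>Y \<in> Obj D. \<forall>Y' \<in> Obj D.
      \<forall>f \<in> homset C X' X. \<forall>h \<in> homset D (FObj L X) Y. \<forall>g \<in> homset D Y Y'.
        \<phi> X' Y' (g \<cdot>\<^bsub>D\<^esub> (h \<cdot>\<^bsub>D\<^esub> FArr L f)) = FArr R g \<cdot>\<^bsub>C\<^esub> (\<phi> X Y h \<cdot>\<^bsub>C\<^esub> f))"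

definition adjoint_pair ::
    "('o1, 'm1, 'z1) cat_scheme \<Rightarrow> ('o2, 'm2, 'z2) cat_scheme
      \<Rightarrow> ('o1, 'm1, 'o2, 'm2) ftr \<Rightarrow> ('o2, 'm2, 'o1, 'm1) ftr \<Rightarrow> bool" where
  "adjoint_pair C D L R \<longleftrightarrow> (\<exists>\<phi>. adjunction C D L R \<phi>)"

definition counit ::
    "('o2, 'm2, 'z2) cat_scheme \<Rightarrow> ('o1, 'm1, 'z1) cat_scheme
      \<Rightarrow> ('o1, 'm1, 'o2, 'm2) ftr \<Rightarrow> ('o2, 'm2, 'o1, 'm1) ftr
      \<Rightarrow> ('o1 \<Rightarrow> 'o2 \<Rightarrow> 'm2 \<Rightarrow> 'm1) \<Rightarrow> 'o2 \<Rightarrow> 'm2" where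
  "counit D C L R \<phi> Y = (THE e. e \<in> homset D (FObj L (FObj R Y)) Y \<and>
    \<phi> (FObj R Y) Y e = Ident C (FObj R Y))"


section \<open>Recollements and the intermediate extension\<close>

text \<open>The parameters are \<open>A'\<close>, \<open>A\<close>, \<open>A''\<close> and the functors
  \<open>i\<^sup>*\<close>, \<open>i\<^sub>*\<close>, \<open>i\<^sup>!\<close>, \<open>j\<^sub>!\<close>, \<open>j\<^sup>*\<close>, \<open>j\<^sub>*\<close>
  (\<open>up\<close>/\<open>dn\<close> for upper/lower index, \<open>s\<close>/\<open>x\<close> for star/exclamation mark).\<close>

locale recollement =
  fixes A' :: "('o1, 'm1) preadd_cat"
    and A :: "('o, 'm) preadd_cat"
    and A'' :: "('o2, 'm2) preadd_cat"
    and i_ups :: "('o, 'm, 'o1, 'm1) ftr"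
    and i_dns :: "('o1, 'm1, 'o, 'm) ftr"
    and i_upx :: "('o, 'm, 'o1, 'm1) ftr"
    and j_dnx :: "('o2, 'm2, 'o, 'm) ftr"
    and j_ups :: "('o, 'm, 'o2, 'm2) ftr"
    and j_dns :: "('o2, 'm2, 'o, 'm) ftr"
  assumes abelian: "abelian_category A'" "abelian_category A" "abelian_category A''"
    and additive: "additive_functor A A' i_ups" "additive_functor A' A i_dns"
      "additive_functor A A' i_upx" "additive_functor A'' A j_dnx"
      "additive_functor A A'' j_ups" "additive_functor A'' A j_dns"
    and adjoint: "adjoint_pair A A' i_ups i_dns" "adjoint_pair A' A i_dns i_upx"
      "adjoint_pair A'' A j_dnx j_ups" "adjoint_pair A A'' j_ups j_dns"
    and full_faithful: "fully_faithful A' A i_dns" "fully_faithful A'' A j_dnx"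
      "fully_faithful A'' A j_dns"
    and Ker_eq_ess_image: "Ker_obj A A'' j_ups = ess_image A' A i_dns"

text \<open>\<open>\<phi>\<close> and \<open>\<psi>\<close> are adjunction isomorphisms for \<open>(j\<^sub>!, j\<^sup>*)\<close> and \<open>(j\<^sup>*, j\<^sub>*)\<close>.
  \<open>\<gamma>\<^sub>M\<close> corresponds to the identity of \<open>M\<close> under
  \<open>Hom(j\<^sub>! M, j\<^sub>* M) \<cong> Hom(M, j\<^sup>* j\<^sub>* M) \<cong> Hom(M, M)\<close>,
  where the second map is composition with the counit.\<close>

definition gamma ::
    "('o, 'm) preadd_cat \<Rightarrow> ('o2, 'm2) preadd_cat
      \<Rightarrow> ('o2, 'm2, 'o, 'm) ftr \<Rightarrow> ('o, 'm, 'o2, 'm2) ftr \<Rightarrow> ('o2, 'm2, 'o, 'm) ftr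
      \<Rightarrow> ('o2 \<Rightarrow> 'o \<Rightarrow> 'm \<Rightarrow> 'm2) \<Rightarrow> ('o \<Rightarrow> 'o2 \<Rightarrow> 'm2 \<Rightarrow> 'm) \<Rightarrow> 'o2 \<Rightarrow> 'm" where
  "gamma A A'' j_dnx j_ups j_dns \<phi> \<psi> M =
    (THE g. g \<in> homset A (FObj j_dnx M) (FObj j_dns M) \<and>
      counit A'' A j_ups j_dns \<psi> M \<cdot>\<^bsub>A''\<^esub> \<phi> M (FObj j_dns M) g = Ident A'' M)"

definition intermediate_extension ::
    "('o, 'm) preadd_cat \<Rightarrow> ('o2, 'm2) preadd_cat
      \<Rightarrow> ('o2, 'm2, 'o, 'm) ftr \<Rightarrow> ('o, 'm, 'o2, 'm2) ftr \<Rightarrow> ('o2, 'm2, 'o, 'm) ftr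
      \<Rightarrow> ('o2 \<Rightarrow> 'o \<Rightarrow> 'm \<Rightarrow> 'm2) \<Rightarrow> ('o \<Rightarrow> 'o2 \<Rightarrow> 'm2 \<Rightarrow> 'm)
      \<Rightarrow> ('o2, 'm2, 'o, 'm) ftr" where
  "intermediate_extension A A'' j_dnx j_ups j_dns \<phi> \<psi> =
    (let \<gamma> = gamma A A'' j_dnx j_ups j_dns \<phi> \<psi> in
      \<lparr>FObj = (\<lambda>M. im_obj A (\<gamma> M)),
       FArr = (\<lambda>f. THE h. h \<in> homset A (im_obj A (\<gamma> (Dom A'' f))) (im_obj A (\<gamma> (Cod A'' f))) \<and>
         im_incl A (\<gamma> (Cod A'' f)) \<cdot>\<^bsub>A\<^esub> h = FArr j_dns f \<cdot>\<^bsub>A\<^esub> im_incl A (\<gamma> (Dom A'' f)))\<rparr>)"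


section \<open>Bricks, epibricks and monobricks\<close>

definition End_ring :: "('o, 'm, 'z) preadd_cat_scheme \<Rightarrow> 'o \<Rightarrow> 'm ring" where
  "End_ring C X = \<lparr>carrier = homset C X X, mult = Comp C, one = Ident C X,
    zero = ZeroArr C X X, add = AddArr C\<rparr>"

text \<open>As in \<^locale>\<open>field\<close>, but without commutativity; the zero ring is excluded since
  its zero is a unit.\<close>

definition division_ring :: "('a, 'z) ring_scheme \<Rightarrow> bool" where
  "division_ring R \<longleftrightarrow> ring R \<and> Units R = carrier R - {\<zero>\<^bsub>R\<^esub>}"

definition brick :: "('o, 'm, 'z) preadd_cat_scheme \<Rightarrow> 'o \<Rightarrow> bool" where
  "brick C X \<longleftrightarrow> X \<in> Obj C \<and> division_ring (End_ring C X)"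

definition iso_classes :: "('o, 'm, 'z) cat_scheme \<Rightarrow> 'o set set" where
  "iso_classes C = Obj C // {(X, Y). isomorphic C X Y}"

definition epibrick :: "('o, 'm, 'z) preadd_cat_scheme \<Rightarrow> 'o set set \<Rightarrow> bool" where
  "epibrick C S \<longleftrightarrow> S \<subseteq> iso_classes C \<and> (\<forall>X \<in> \<Union>S. brick C X) \<and>
    (\<forall>X \<in> \<Union>S. \<forall>Y \<in> \<Union>S. \<forall>f \<in> homset C X Y. f = ZeroArr C X Y \<or> epi_arr C f)"

definition monobrick :: "('o, 'm, 'z) preadd_cat_scheme \<Rightarrow> 'o set set \<Rightarrow> bool" where
  "monobrick C S \<longleftrightarrow> S \<subseteq> iso_classes C \<and> (\<forall>X \<in> \<Union>S. brick C X) \<and>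
    (\<forall>X \<in> \<Union>S. \<forall>Y \<in> \<Union>S. \<forall>f \<in> homset C X Y. f = ZeroArr C X Y \<or> mono_arr C f)"

definition ftr_image ::
    "('o2, 'm2, 'z) cat_scheme \<Rightarrow> ('o1, 'm1, 'o2, 'm2) ftr \<Rightarrow> 'o1 set set \<Rightarrow> 'o2 set set" where
  "ftr_image D F S = {{Y. isomorphic D (FObj F X) Y} | X. X \<in> \<Union>S}"

end

theory Submission
  imports Defs
begin

text \<open>Fully faithful functors preserve bricks, and left (right) adjoints preserve epimorphisms
  (monomorphisms); this gives (2) and (1) for \<open>i\<^sub>*\<close>. Now call an object \<open>X\<close> of \<open>A\<close> clean
  if \<open>j\<^sup>*\<close> is faithful on the morphisms from \<open>X\<close> and on those to \<open>X\<close>. By adjunction \<open>j\<^sup>*\<close> is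
  faithful on morphisms from \<open>j\<^sub>! M\<close> and on morphisms to \<open>j\<^sub>* M\<close>; the former passes to quotients
  and the latter to subobjects, so \<open>j\<^sub>!\<^sub>* M\<close> is clean. Between clean objects \<open>j\<^sup>*\<close> reflects zero
  morphisms, monomorphisms and epimorphisms, and there are no nonzero morphisms between a clean
  object and an object \<open>i\<^sub>* B\<close>, which is killed by \<open>j\<^sup>*\<close>. As \<open>j\<^sup>* j\<^sub>!\<^sub>* M\<close> is isomorphic to \<open>M\<close>,
  this gives the rest of (1) and (3), without fullness of \<open>j\<^sub>!\<^sub>*\<close>. If \<open>i\<^sup>*\<close> (resp. \<open>i\<^sup>!\<close>) is
  exact, then \<open>j\<^sub>! M\<close> (resp. \<open>j\<^sub>* M\<close>) is itself clean, whence (4). Monobricks are epibricks of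
  the opposite category, and the opposite of a recollement is a recollement.\<close>

section \<open>Categories and their opposites\<close>

lemma homset_Dom: "f \<in> homset C X Y \<Longrightarrow> Dom C f = X"
  and homset_Cod: "f \<in> homset C X Y \<Longrightarrow> Cod C f = Y"
  and homset_Arr: "f \<in> homset C X Y \<Longrightarrow> f \<in> Arr C"
  by (simp_all add: homset_def)

lemma epi_arrI:
  assumes "f \<in> homset C X Y"
    and "\<And>Z g h. \<lbrakk>g \<in> homset C Y Z; h \<in> homset C Y Z; g \<cdot>\<^bsub>C\<^esub> f = h \<cdot>\<^bsub>C\<^esub> f\<rbrakk> \<Longrightarrow> g = h"
  shows "epi_arr C f"
  using assms by (auto simp: epi_arr_def homset_Cod homset_Arr)

lemma epi_arrD:
  "\<lbrakk>epi_arr C f; f \<in> homset C X Y; g \<in> homset C Y Z; h \<in> homset C Y Z;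
    g \<cdot>\<^bsub>C\<^esub> f = h \<cdot>\<^bsub>C\<^esub> f\<rbrakk> \<Longrightarrow> g = h"
  by (metis epi_arr_def homset_Cod)

lemma mono_arrD:
  "\<lbrakk>mono_arr C f; f \<in> homset C X Y; g \<in> homset C W X; h \<in> homset C W X;
    f \<cdot>\<^bsub>C\<^esub> g = f \<cdot>\<^bsub>C\<^esub> h\<rbrakk> \<Longrightarrow> g = h"
  by (metis mono_arr_def homset_Dom)

text \<open>The reversed category keeps the record type and the names of objects and arrows, so any
  locale result can be instantiated at \<open>op_cat C\<close> and simplified back to a dual
  statement about \<open>C\<close>.\<close>

definition op_cat :: "('o, 'm, 'z) preadd_cat_scheme \<Rightarrow> ('o, 'm, 'z) preadd_cat_scheme" where
  "op_cat C = C\<lparr>Dom := Cod C, Cod := Dom C, Comp := (\<lambda>g f. f \<cdot>\<^bsub>C\<^esub> g),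
    ZeroArr := (\<lambda>X Y. ZeroArr C Y X)\<rparr>"

lemma op_cat_simps [simp]:
  "Obj (op_cat C) = Obj C" "Arr (op_cat C) = Arr C" "Dom (op_cat C) = Cod C"
  "Cod (op_cat C) = Dom C" "Ident (op_cat C) = Ident C" "g \<cdot>\<^bsub>op_cat C\<^esub> f = f \<cdot>\<^bsub>C\<^esub> g"
  "ZeroArr (op_cat C) X Y = ZeroArr C Y X" "AddArr (op_cat C) = AddArr C"
  by (simp_all add: op_cat_def)

lemma homset_op_cat [simp]: "homset (op_cat C) X Y = homset C Y X"
  by (auto simp: homset_def)

lemma hom_group_op_cat [simp]: "hom_group (op_cat C) X Y = hom_group C Y X"
  by (simp add: hom_group_def)

lemma mono_arr_op_cat [simp]: "mono_arr (op_cat C) f \<longleftrightarrow> epi_arr C f"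
  and epi_arr_op_cat [simp]: "epi_arr (op_cat C) f \<longleftrightarrow> mono_arr C f"
  by (simp_all add: mono_arr_def epi_arr_def)

lemma is_kernel_op_cat [simp]: "is_kernel (op_cat C) f k \<longleftrightarrow> is_cokernel C f k"
  and is_cokernel_op_cat [simp]: "is_cokernel (op_cat C) f k \<longleftrightarrow> is_kernel C f k"
  by (simp_all add: is_kernel_def is_cokernel_def)

lemma zero_object_op_cat [simp]: "zero_object (op_cat C) Z \<longleftrightarrow> zero_object C Z"
  by (auto simp: zero_object_def)

lemma isomorphic_op_cat [simp]: "isomorphic (op_cat C) X Y \<longleftrightarrow> isomorphic C X Y"
  by (auto simp: isomorphic_def)

lemma biproduct_op_cat [simp]:
  "biproduct (op_cat C) X Y P i1 i2 p1 p2 \<longleftrightarrow> biproduct C X Y P p1 p2 i1 i2"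
  by (auto simp: biproduct_def)

section \<open>Composites, split epimorphisms and retractions\<close>

context category
begin

lemma homset_Obj: "f \<in> homset C X Y \<Longrightarrow> X \<in> Obj C" "f \<in> homset C X Y \<Longrightarrow> Y \<in> Obj C"
  using Dom_Obj Cod_Obj by (auto simp: homset_def)

lemma epi_arr_Comp:
  assumes "epi_arr C f" "epi_arr C g" "f \<in> homset C X Y" "g \<in> homset C Y Z"
  shows "epi_arr C (g \<cdot> f)"
proof (rule epi_arrI[OF Comp_hom[OF assms(3,4)]])
  fix W h k assume hk: "h \<in> homset C Z W" "k \<in> homset C Z W" "h \<cdot> (g \<cdot> f) = k \<cdot> (g \<cdot> f)"
  then have "(h \<cdot> g) \<cdot> f = (k \<cdot> g) \<cdot> f"
    by (simp add: Comp_assoc[OF assms(3,4)])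
  then have "h \<cdot> g = k \<cdot> g"
    using epi_arrD[OF assms(1,3)] Comp_hom assms(4) hk by blast
  then show "h = k" using epi_arrD[OF assms(2,4)] hk by blast
qed

lemma split_epi_arr:
  assumes "f \<in> homset C X Y" "g \<in> homset C Y X" "f \<cdot> g = Ident C Y"
  shows "epi_arr C f"
proof (rule epi_arrI[OF assms(1)])
  fix Z h k assume hk: "h \<in> homset C Y Z" "k \<in> homset C Y Z" "h \<cdot> f = k \<cdot> f"
  have "u = (u \<cdot> f) \<cdot> g" if "u \<in> homset C Y Z" for u
    using Comp_assoc[OF assms(2,1) that] assms(3) Comp_Ident[OF that] by simp
  then show "h = k" using hk by metis
qed

lemma isomorphic_refl: "X \<in> Obj C \<Longrightarrow> isomorphic C X X"
  unfolding isomorphic_def using Ident_hom Comp_Ident by blast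

lemma retract_cancel:
  assumes "f \<in> homset C X Y" "s \<in> homset C Y Z" "r \<in> homset C Z Y" "r \<cdot> s = Ident C Y"
  shows "r \<cdot> (s \<cdot> f) = f"
  using Comp_assoc[OF assms(1-3)] Ident_Comp[OF assms(1)] assms(4) by simp

end

section \<open>Preadditive and abelian categories\<close>

context preadditive_category
begin

lemma ZeroArr_hom: "\<lbrakk>X \<in> Obj C; Y \<in> Obj C\<rbrakk> \<Longrightarrow> ZeroArr C X Y \<in> homset C X Y"
  using monoid.one_closed[OF comm_monoid.axioms(1)[OF comm_group.axioms(1)[OF hom_comm_group]]]
  by (simp add: hom_group_def)

lemma Zero_Add: "f \<in> homset C X Y \<Longrightarrow> AddArr C (ZeroArr C X Y) f = f"
proof -
  assume f: "f \<in> homset C X Y"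
  interpret comm_group "hom_group C X Y" by (rule hom_comm_group[OF homset_Obj[OF f]])
  show ?thesis using l_one[of f] f by (simp add: hom_group_def)
qed

lemma Add_eq_right_imp_Zero:
  "\<lbrakk>f \<in> homset C X Y; g \<in> homset C X Y; AddArr C f g = g\<rbrakk> \<Longrightarrow> f = ZeroArr C X Y"
proof -
  assume f: "f \<in> homset C X Y" "g \<in> homset C X Y" "AddArr C f g = g"
  interpret comm_group "hom_group C X Y" by (rule hom_comm_group[OF homset_Obj[OF f(1)]])
  show ?thesis using r_cancel_one[of g f] f by (simp add: hom_group_def)
qed

text \<open>The inverse is taken in the hom group, written multiplicatively there. Differences
  reduce the comparison of parallel arrows to the vanishing of one arrow.\<close>

lemma ex_difference:
  "\<lbrakk>f \<in> homset C X Y; g \<in> homset C X Y\<rbrakk> \<Longrightarrow> \<exists>d \<in> homset C X Y. f = AddArr C d g"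
proof -
  assume f: "f \<in> homset C X Y" "g \<in> homset C X Y"
  let ?G = "hom_group C X Y"
  interpret comm_group ?G by (rule hom_comm_group[OF homset_Obj[OF f(1)]])
  have fg: "f \<in> carrier ?G" "g \<in> carrier ?G" using f by (simp_all add: hom_group_def)
  then have "(f \<otimes>\<^bsub>?G\<^esub> inv\<^bsub>?G\<^esub> g) \<otimes>\<^bsub>?G\<^esub> g = f"
    by (simp add: m_assoc)
  moreover have "f \<otimes>\<^bsub>?G\<^esub> inv\<^bsub>?G\<^esub> g \<in> carrier ?G" using fg by simp
  ultimately show ?thesis by (metis hom_group_def monoid.simps(1) partial_object.simps(1))
qed

text \<open>Since 0 + 0 = 0, the composite equals its own double, and cancellation in the hom group
  makes it zero.\<close>

lemma Comp_Zero:
  assumes "g \<in> homset C Y Z" "X \<in> Obj C"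
  shows "g \<cdot> ZeroArr C X Y = ZeroArr C X Z"
proof -
  have z: "ZeroArr C X Y \<in> homset C X Y" using assms homset_Obj ZeroArr_hom by blast
  have "AddArr C (g \<cdot> ZeroArr C X Y) (g \<cdot> ZeroArr C X Y) = g \<cdot> ZeroArr C X Y"
    using Add_Comp[OF z z assms(1)] Zero_Add[OF z] by simp
  then show ?thesis using Add_eq_right_imp_Zero Comp_hom[OF z assms(1)] by blast
qed

lemma preadditive_op_cat: "preadditive_category (op_cat C)"
proof (intro preadditive_category.intro category.intro preadditive_category_axioms.intro)
  show "(h \<cdot>\<^bsub>op_cat C\<^esub> g) \<cdot>\<^bsub>op_cat C\<^esub> f = h \<cdot>\<^bsub>op_cat C\<^esub> (g \<cdot>\<^bsub>op_cat C\<^esub> f)"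
    if "f \<in> homset (op_cat C) X Y" "g \<in> homset (op_cat C) Y Z" "h \<in> homset (op_cat C) Z W"
    for f g h X Y Z W using that Comp_assoc by simp
qed (auto simp: Dom_Obj Cod_Obj Ident_hom Comp_Ident Ident_Comp hom_comm_group
    Comp_Add Add_Comp intro: Comp_hom)

lemma Zero_Comp:
  "\<lbrakk>f \<in> homset C X Y; Z \<in> Obj C\<rbrakk> \<Longrightarrow> ZeroArr C Y Z \<cdot> f = ZeroArr C X Z"
  using preadditive_category.Comp_Zero[OF preadditive_op_cat] by simp

text \<open>Two arrows that agree after \<open>f\<close> differ by an arrow whose composite with
  \<open>f\<close> is zero.\<close>

lemma epi_arrI_Zero:
  assumes f: "f \<in> homset C X Y"
    and zero: "\<And>Z g. \<lbrakk>g \<in> homset C Y Z; g \<cdot> f = ZeroArr C X Z\<rbrakk> \<Longrightarrow> g = ZeroArr C Y Z"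
  shows "epi_arr C f"
proof (rule epi_arrI[OF f])
  fix Z g h assume gh: "g \<in> homset C Y Z" "h \<in> homset C Y Z" "g \<cdot> f = h \<cdot> f"
  obtain d where d: "d \<in> homset C Y Z" "g = AddArr C d h" using ex_difference gh by blast
  have "AddArr C (d \<cdot> f) (h \<cdot> f) = h \<cdot> f" using Comp_Add[OF f d(1) gh(2)] gh(3) d(2) by simp
  then have "d \<cdot> f = ZeroArr C X Z" using Add_eq_right_imp_Zero Comp_hom[OF f] d gh by blast
  then show "g = h" using zero[OF d(1)] d(2) Zero_Add[OF gh(2)] by simp
qed

lemma epi_arrD_Zero:
  assumes "epi_arr C f" "f \<in> homset C X Y" "g \<in> homset C Y Z" "g \<cdot> f = ZeroArr C X Z"
  shows "g = ZeroArr C Y Z"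
  using epi_arrD[OF assms(1,2,3)] assms ZeroArr_hom Zero_Comp homset_Obj by metis

lemma mono_arrD_Zero:
  "\<lbrakk>mono_arr C f; f \<in> homset C X Y; g \<in> homset C W X; f \<cdot> g = ZeroArr C W Y\<rbrakk>
    \<Longrightarrow> g = ZeroArr C W X"
  using preadditive_category.epi_arrD_Zero[OF preadditive_op_cat, where X = Y and Y = X and Z = W] by simp

lemma Ident_Zero_imp:
  assumes "Ident C X = ZeroArr C X X" "f \<in> homset C X Y"
  shows "f = ZeroArr C X Y"
  using assms Comp_Ident Comp_Zero homset_Obj by metis

lemma Ident_Zero_imp':
  "\<lbrakk>Ident C Y = ZeroArr C Y Y; f \<in> homset C X Y\<rbrakk> \<Longrightarrow> f = ZeroArr C X Y"
  using preadditive_category.Ident_Zero_imp[OF preadditive_op_cat, where X = Y and Y = X] by simp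

text \<open>Every arrow from or to \<open>X\<close> factors through the identity of
  \<open>X\<close>, so all of them vanish once the identity does; \<open>ZeroArr\<close> supplies
  existence.\<close>

lemma zero_object_iff:
  "zero_object C X \<longleftrightarrow> X \<in> Obj C \<and> Ident C X = ZeroArr C X X"
proof
  show "X \<in> Obj C \<and> Ident C X = ZeroArr C X X" if "zero_object C X"
    using that Ident_hom ZeroArr_hom unfolding zero_object_def by blast
  show "zero_object C X" if "X \<in> Obj C \<and> Ident C X = ZeroArr C X X"
    unfolding zero_object_def
    using that Ident_Zero_imp Ident_Zero_imp' ZeroArr_hom by metis
qed

lemma split_mono_arr:
  "\<lbrakk>f \<in> homset C X Y; g \<in> homset C Y X; g \<cdot> f = Ident C X\<rbrakk> \<Longrightarrow> mono_arr C f"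
  using category.split_epi_arr[of "op_cat C" f Y X g] preadditive_op_cat
  by (simp add: preadditive_category_def)

lemma zero_object_of_mono:
  assumes "f \<in> homset C X Y" "mono_arr C f" "f = ZeroArr C X Y"
  shows "zero_object C X"
proof -
  have X: "X \<in> Obj C" using homset_Obj(1)[OF assms(1)] .
  have "f \<cdot> Ident C X = ZeroArr C X Y" using Comp_Ident[OF assms(1)] assms(3) by simp
  then have "Ident C X = ZeroArr C X X"
    by (rule mono_arrD_Zero[OF assms(2,1) Ident_hom[OF X]])
  then show ?thesis using zero_object_iff X by simp
qed

section \<open>Kernels and cokernels\<close>

lemma kernel_mono:
  assumes "is_kernel C f k"
  shows "mono_arr C k"
  unfolding mono_arr_def
proof (intro conjI allI ballI impI)
  show "k \<in> Arr C" using assms by (simp add: is_kernel_def)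
  fix W g h assume gh: "g \<in> homset C W (Dom C k)" "h \<in> homset C W (Dom C k)" "k \<cdot> g = k \<cdot> h"
  have f: "f \<in> homset C (Dom C f) (Cod C f)" and k: "k \<in> homset C (Dom C k) (Dom C f)"
    using assms by (simp_all add: is_kernel_def homset_def)
  have "f \<cdot> (k \<cdot> g) = ZeroArr C W (Cod C f)"
    using Comp_assoc[OF gh(1) k f] Zero_Comp[OF gh(1)] homset_Obj f assms
    by (metis is_kernel_def)
  \<comment> \<open>Both \<open>g\<close> and \<open>h\<close> lift the arrow
    \<open>k \<cdot> g\<close>, which \<open>f\<close> kills, so uniqueness of the lift compares
    them.\<close>
  then have "\<exists>!u. u \<in> homset C W (Dom C k) \<and> k \<cdot> u = k \<cdot> g"
    using assms Comp_hom[OF gh(1) k] unfolding is_kernel_def by blast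
  then show "g = h" using gh by metis
qed

lemma kernel_hom: "\<lbrakk>is_kernel C f k; f \<in> homset C X Y\<rbrakk> \<Longrightarrow> k \<in> homset C (Dom C k) X"
  by (auto simp: is_kernel_def homset_def)

lemma kernel_Comp:
  "\<lbrakk>is_kernel C f k; f \<in> homset C X Y; k \<in> homset C K X\<rbrakk> \<Longrightarrow> f \<cdot> k = ZeroArr C K Y"
  by (auto simp: is_kernel_def homset_def)

lemma kernel_lift:
  assumes "is_kernel C f k" "f \<in> homset C X Y" "k \<in> homset C K X"
    and "h \<in> homset C W X" "f \<cdot> h = ZeroArr C W Y"
  shows "\<exists>u \<in> homset C W K. k \<cdot> u = h"
proof -
  have "\<exists>!u. u \<in> homset C W (Dom C k) \<and> k \<cdot> u = h"
    using assms unfolding is_kernel_def homset_Dom[OF assms(2)] homset_Cod[OF assms(2)] by blast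
  then show ?thesis using homset_Dom[OF assms(3)] by blast
qed

text \<open>Monicity of \<open>k\<close> gives uniqueness of the lift, leaving only existence to
  check.\<close>

lemma is_kernelI:
  assumes "f \<in> homset C X Y" "k \<in> homset C K X" "f \<cdot> k = ZeroArr C K Y" "mono_arr C k"
    and lift: "\<And>W h. \<lbrakk>h \<in> homset C W X; f \<cdot> h = ZeroArr C W Y\<rbrakk> \<Longrightarrow> \<exists>u \<in> homset C W K. k \<cdot> u = h"
  shows "is_kernel C f k"
proof -
  have "\<exists>!u. u \<in> homset C W K \<and> k \<cdot> u = h" if "h \<in> homset C W X" "f \<cdot> h = ZeroArr C W Y" for W h
    using lift[OF that] mono_arrD[OF assms(4,2), of _ W] by blast
  then show ?thesis
    using assms by (simp add: is_kernel_def homset_Dom homset_Cod homset_Arr)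
qed

lemma cokernel_hom: "\<lbrakk>is_cokernel C f c; f \<in> homset C X Y\<rbrakk> \<Longrightarrow> c \<in> homset C Y (Cod C c)"
  by (auto simp: is_cokernel_def homset_def)

lemma cokernel_Comp:
  "\<lbrakk>is_cokernel C f c; f \<in> homset C X Y; c \<in> homset C Y Q\<rbrakk> \<Longrightarrow> c \<cdot> f = ZeroArr C X Q"
  by (auto simp: is_cokernel_def homset_def)

lemma cokernel_desc:
  "\<lbrakk>is_cokernel C f c; f \<in> homset C X Y; c \<in> homset C Y Q; h \<in> homset C Y W;
    h \<cdot> f = ZeroArr C X W\<rbrakk> \<Longrightarrow> \<exists>u \<in> homset C Q W. u \<cdot> c = h"
  using preadditive_category.kernel_lift[OF preadditive_op_cat, where X = Y and Y = X and K = Q]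
  by simp

end

section \<open>Balancedness and image factorizations in abelian categories\<close>

context abelian_category
begin

lemma abelian_op_cat: "abelian_category (op_cat C)"
proof (intro abelian_category.intro abelian_category_axioms.intro)
  show "preadditive_category (op_cat C)" by (rule preadditive_op_cat)
next
  fix X Y assume "X \<in> Obj (op_cat C)" "Y \<in> Obj (op_cat C)"
  then have "\<exists>P i1 i2 p1 p2. biproduct C X Y P i1 i2 p1 p2" by (simp add: ex_biproduct)
  then show "\<exists>P i1 i2 p1 p2. biproduct (op_cat C) X Y P i1 i2 p1 p2" by (metis biproduct_op_cat)
qed (auto simp: ex_zero_object ex_kernel ex_cokernel mono_is_kernel epi_is_cokernel)

text \<open>The mono is a kernel of some \<open>g\<close>, and \<open>g\<close> factors through
  \<open>c\<close>; hence whatever \<open>c\<close> kills is killed by \<open>g\<close> and lifts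
  through \<open>m\<close>.\<close>

lemma mono_kernel_of_cokernel:
  assumes mono: "mono_arr C m" and c: "is_cokernel C m c"
  shows "is_kernel C c m"
proof -
  have m: "m \<in> homset C (Dom C m) (Cod C m)" using mono by (simp add: mono_arr_def homset_def)
  define Q where "Q = Cod C c"
  have Q: "c \<in> homset C (Cod C m) Q" using cokernel_hom[OF c m] unfolding Q_def .
  obtain g where g: "is_kernel C g m" using mono_is_kernel[OF mono] by blast
  define V where "V = Cod C g"
  have V: "g \<in> homset C (Cod C m) V" using g by (simp add: is_kernel_def homset_def V_def)
  obtain t where t: "t \<in> homset C Q V" "t \<cdot> c = g"
    using cokernel_desc[OF c m Q V kernel_Comp[OF g V m]] by blast
  show ?thesis
  proof (rule is_kernelI[OF Q m cokernel_Comp[OF c m Q] mono])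
    fix W h assume h: "h \<in> homset C W (Cod C m)" "c \<cdot> h = ZeroArr C W Q"
    have "g \<cdot> h = ZeroArr C W V"
      using Comp_assoc[OF h(1) Q t(1)] Comp_Zero[OF t(1)] homset_Obj[OF h(1)] h(2) t(2) by simp
    then show "\<exists>u \<in> homset C W (Dom C m). m \<cdot> u = h" using kernel_lift[OF g V m h(1)] by blast
  qed
qed

lemma epi_cokernel_of_kernel: "\<lbrakk>epi_arr C e; is_kernel C e k\<rbrakk> \<Longrightarrow> is_cokernel C k e"
  using abelian_category.mono_kernel_of_cokernel[OF abelian_op_cat, of e k] by simp

text \<open>The cokernel of the epimorphism \<open>f\<close> is zero, so the identity of
  \<open>Y\<close> lifts through \<open>f\<close>, which is a kernel of that cokernel. This right
  inverse is two-sided because \<open>f\<close> is monic.\<close>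

lemma mono_epi_imp_iso:
  assumes f: "f \<in> homset C X Y" and "mono_arr C f" "epi_arr C f"
  shows "\<exists>g \<in> homset C Y X. g \<cdot> f = Ident C X \<and> f \<cdot> g = Ident C Y"
proof -
  obtain c where c: "is_cokernel C f c" using ex_cokernel homset_Arr[OF f] by blast
  define Q where "Q = Cod C c"
  have Q: "c \<in> homset C Y Q" using cokernel_hom[OF c f] unfolding Q_def .
  have "c = ZeroArr C Y Q" using epi_arrD_Zero[OF assms(3) f Q cokernel_Comp[OF c f Q]] .
  then have "c \<cdot> Ident C Y = ZeroArr C Y Q" using Comp_Ident[OF Q] by simp
  then obtain g where g: "g \<in> homset C Y X" "f \<cdot> g = Ident C Y"
    using kernel_lift[OF mono_kernel_of_cokernel[OF assms(2) c] Q f Ident_hom] homset_Obj[OF f]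
    by blast
  have "f \<cdot> (g \<cdot> f) = f \<cdot> Ident C X"
    using Comp_assoc[OF f g(1) f] g(2) Comp_Ident[OF f] Ident_Comp[OF f] by simp
  then have "g \<cdot> f = Ident C X"
    using mono_arrD[OF assms(2) f Comp_hom[OF f g(1)]] Ident_hom homset_Obj[OF f] by blast
  then show ?thesis using g by blast
qed

text \<open>The arrow \<open>e\<close> is the lift of \<open>f\<close> through the kernel
  \<open>m\<close> of its cokernel. It is epic because an arrow \<open>h\<close> killing it would
  confine \<open>f\<close> to the kernel of \<open>h\<close>, a subobject of the image that has to
  be the whole image.\<close>

lemma image_factorization:
  assumes f: "f \<in> homset C X Y" and m: "is_image C f m"
  obtains I e where "e \<in> homset C X I" "m \<in> homset C I Y" "epi_arr C e" "mono_arr C m" "m \<cdot> e = f"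
proof -
  obtain c where c: "is_cokernel C f c" and m': "is_kernel C c m"
    using m unfolding is_image_def by blast
  define Q where "Q = Cod C c"
  have Q: "c \<in> homset C Y Q" using cokernel_hom[OF c f] unfolding Q_def .
  define I where "I = Dom C m"
  have I: "m \<in> homset C I Y" using kernel_hom[OF m' Q] unfolding I_def .
  have mono: "mono_arr C m" using kernel_mono[OF m'] .
  obtain e where e: "e \<in> homset C X I" "m \<cdot> e = f"
    using kernel_lift[OF m' Q I f cokernel_Comp[OF c f Q]] by blast
  have "epi_arr C e"
  proof (rule epi_arrI_Zero[OF e(1)])
    fix Z h assume h: "h \<in> homset C I Z" "h \<cdot> e = ZeroArr C X Z"
    obtain k where k: "is_kernel C h k" using ex_kernel homset_Arr[OF h(1)] by blast
    define K where "K = Dom C k"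
    have K: "k \<in> homset C K I" using kernel_hom[OF k h(1)] unfolding K_def .
    obtain e' where e': "e' \<in> homset C X K" "k \<cdot> e' = e"
      using kernel_lift[OF k h(1) K e(1) h(2)] by blast
    have mk: "m \<cdot> k \<in> homset C K Y" using Comp_hom K I by blast
    \<comment> \<open>\<open>f\<close> factors through the subobject \<open>m \<cdot> k\<close>, which must therefore contain the image.\<close>
    have "mono_arr C (m \<cdot> k)"
      using category.epi_arr_Comp[of "op_cat C" m k Y I K] preadditive_op_cat K I mono kernel_mono[OF k]
      by (simp add: preadditive_category_def)
    then obtain g where g: "is_kernel C g (m \<cdot> k)" using mono_is_kernel by blast
    define V where "V = Cod C g"
    have V: "g \<in> homset C Y V"
      using g homset_Cod[OF mk] by (simp add: is_kernel_def homset_def V_def)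
    have "f = (m \<cdot> k) \<cdot> e'" using Comp_assoc[OF e'(1) K I] e e' by simp
    then have "g \<cdot> f = ZeroArr C X V"
      using Comp_assoc[OF e'(1) mk V] kernel_Comp[OF g V mk] Zero_Comp[OF e'(1)] homset_Obj[OF V] by simp
    then obtain t where t: "t \<in> homset C Q V" "t \<cdot> c = g" using cokernel_desc[OF c f Q V] by blast
    have "g \<cdot> m = ZeroArr C I V"
      using Comp_assoc[OF I Q t(1)] kernel_Comp[OF m' Q I] t(2) Comp_Zero[OF t(1)] homset_Obj[OF I] by simp
    \<comment> \<open>Lifting \<open>m\<close> through its own subobject gives a right inverse
      \<open>s\<close> of \<open>k\<close>; as \<open>h \<cdot> k\<close> is zero, so is
      \<open>h\<close>.\<close>
    then obtain s where s: "s \<in> homset C I K" "(m \<cdot> k) \<cdot> s = m" using kernel_lift[OF g V mk I] by blast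
    have "m \<cdot> (k \<cdot> s) = m \<cdot> Ident C I"
      using Comp_assoc[OF s(1) K I] s Comp_Ident[OF I] by simp
    then have ks: "k \<cdot> s = Ident C I"
      using mono_arrD[OF mono I Comp_hom[OF s(1) K]] Ident_hom homset_Obj[OF I] by blast
    have "h = h \<cdot> (k \<cdot> s)" using ks Comp_Ident[OF h(1)] by simp
    also have "\<dots> = ZeroArr C I Z"
      using Comp_assoc[OF s(1) K h(1)] kernel_Comp[OF k h(1) K] Zero_Comp[OF s(1)] homset_Obj[OF h(1)] by simp
    finally show "h = ZeroArr C I Z" .
  qed
  then show ?thesis using that e I mono by blast
qed

lemma ex_image: "f \<in> Arr C \<Longrightarrow> \<exists>m. is_image C f m"
  unfolding is_image_def using ex_cokernel ex_kernel by (metis is_cokernel_def)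

text \<open>The image required by \<open>short_exact\<close> is \<open>f\<close> itself, being a
  kernel of its cokernel \<open>g\<close>.\<close>

lemma short_exactI:
  assumes "is_kernel C g f" "is_cokernel C f g"
  shows "short_exact C f g"
  using assms kernel_mono preadditive_category.kernel_mono[OF preadditive_op_cat, of f g]
  unfolding short_exact_def is_image_def by auto

end

section \<open>Functors and adjunctions\<close>

lemma additive_functor_op_cat:
  "additive_functor C D F \<Longrightarrow> additive_functor (op_cat C) (op_cat D) F"
  by (rule additive_functor.intro)
    (auto simp: additive_functor.FObj_Obj additive_functor.FArr_hom additive_functor.FArr_Ident
      additive_functor.FArr_Comp additive_functor.FArr_Add)

lemma fully_faithful_op_cat:
  "fully_faithful (op_cat C) (op_cat D) F \<longleftrightarrow> fully_faithful C D F"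
  unfolding fully_faithful_def by auto

lemma FArr_ZeroArr:
  assumes "preadditive_category C" "preadditive_category D" "additive_functor C D F"
    and "X \<in> Obj C" "Y \<in> Obj C"
  shows "FArr F (ZeroArr C X Y) = ZeroArr D (FObj F X) (FObj F Y)"
proof -
  interpret C: preadditive_category C by fact
  interpret D: preadditive_category D by fact
  interpret F: additive_functor C D F by fact
  have z: "ZeroArr C X Y \<in> homset C X Y" using C.ZeroArr_hom assms(4,5) .
  have "AddArr D (FArr F (ZeroArr C X Y)) (FArr F (ZeroArr C X Y)) = FArr F (ZeroArr C X Y)"
    using F.FArr_Add[OF z z] C.Zero_Add[OF z] by simp
  then show ?thesis using D.Add_eq_right_imp_Zero F.FArr_hom[OF z] by blast
qed

text \<open>Exactness speaks of short exact sequences only; a monomorphism is completed to one by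
  its cokernel.\<close>

lemma exact_functor_mono:
  assumes "abelian_category C" "exact_functor C D F" "mono_arr C m"
  shows "mono_arr D (FArr F m)"
proof -
  interpret abelian_category C by fact
  obtain c where c: "is_cokernel C m c"
    using ex_cokernel assms(3) unfolding mono_arr_def by blast
  then have "short_exact C m c"
    using short_exactI mono_kernel_of_cokernel assms(3) by blast
  then show ?thesis using assms(2) unfolding exact_functor_def short_exact_def by blast
qed

lemma exact_functor_epi:
  assumes "abelian_category C" "exact_functor C D F" "epi_arr C e"
  shows "epi_arr D (FArr F e)"
proof -
  interpret abelian_category C by fact
  obtain k where k: "is_kernel C e k"
    using ex_kernel assms(3) unfolding epi_arr_def by blast
  then have "short_exact C k e"
    using short_exactI epi_cokernel_of_kernel assms(3) by blast
  then show ?thesis using assms(2) unfolding exact_functor_def short_exact_def by blast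
qed

section \<open>Adjunctions between additive functors\<close>

locale additive_adjunction =
  C: preadditive_category C + D: preadditive_category D +
  L: additive_functor C D L + R: additive_functor D C R
  for C :: "('o1, 'm1, 'z1) preadd_cat_scheme" and D :: "('o2, 'm2, 'z2) preadd_cat_scheme"
    and L R +
  fixes \<phi>
  assumes adjunction: "adjunction C D L R \<phi>"
begin

lemma bij_hom:
  "\<lbrakk>X \<in> Obj C; Y \<in> Obj D\<rbrakk> \<Longrightarrow> bij_betw (\<phi> X Y) (homset D (FObj L X) Y) (homset C X (FObj R Y))"
  using adjunction unfolding adjunction_def by blast

lemma transpose_hom:
  "\<lbrakk>X \<in> Obj C; h \<in> homset D (FObj L X) Y\<rbrakk> \<Longrightarrow> \<phi> X Y h \<in> homset C X (FObj R Y)"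
  using bij_hom[of X Y] D.homset_Obj bij_betwE by blast

lemma transpose_inj:
  "\<lbrakk>X \<in> Obj C; g \<in> homset D (FObj L X) Y; h \<in> homset D (FObj L X) Y; \<phi> X Y g = \<phi> X Y h\<rbrakk> \<Longrightarrow> g = h"
  by (rule inj_onD[OF bij_betw_imp_inj_on[OF bij_hom[OF _ D.homset_Obj(2)]]])

lemma transpose_surj:
  assumes "Y \<in> Obj D" "h \<in> homset C X (FObj R Y)"
  shows "\<exists>g \<in> homset D (FObj L X) Y. \<phi> X Y g = h"
proof -
  have "h \<in> \<phi> X Y ` homset D (FObj L X) Y"
    using bij_betw_imp_surj_on[OF bij_hom[OF C.homset_Obj(1)[OF assms(2)] assms(1)]] assms(2) by simp
  then show ?thesis by auto
qed

lemma transpose_nat: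
  assumes "f \<in> homset C X' X" "h \<in> homset D (FObj L X) Y" "g \<in> homset D Y Y'"
  shows "\<phi> X' Y' (g \<cdot>\<^bsub>D\<^esub> (h \<cdot>\<^bsub>D\<^esub> FArr L f)) = FArr R g \<cdot>\<^bsub>C\<^esub> (\<phi> X Y h \<cdot>\<^bsub>C\<^esub> f)"
  using adjunction[unfolded adjunction_def, THEN conjunct2, rule_format,
      OF C.homset_Obj(2,1)[OF assms(1)] D.homset_Obj[OF assms(3)] assms(1,2,3)] .

lemma transpose_Comp_left:
  assumes "f \<in> homset C X' X" "h \<in> homset D (FObj L X) Y"
  shows "\<phi> X' Y (h \<cdot>\<^bsub>D\<^esub> FArr L f) = \<phi> X Y h \<cdot>\<^bsub>C\<^esub> f"
proof -
  note o = C.homset_Obj[OF assms(1)] D.homset_Obj(2)[OF assms(2)]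
  show ?thesis
    using transpose_nat[OF assms D.Ident_hom[OF o(3)]]
    unfolding R.FArr_Ident[OF o(3)] D.Ident_Comp[OF D.Comp_hom[OF L.FArr_hom[OF assms(1)] assms(2)]]
      C.Ident_Comp[OF C.Comp_hom[OF assms(1) transpose_hom[OF o(2) assms(2)]]] .
qed

lemma transpose_Comp_right:
  assumes "X \<in> Obj C" "h \<in> homset D (FObj L X) Y" "g \<in> homset D Y Y'"
  shows "\<phi> X Y' (g \<cdot>\<^bsub>D\<^esub> h) = FArr R g \<cdot>\<^bsub>C\<^esub> \<phi> X Y h"
  using transpose_nat[OF C.Ident_hom[OF assms(1)] assms(2,3)] L.FArr_Ident[OF assms(1)]
    D.Comp_Ident[OF assms(2)] C.Comp_Ident[OF transpose_hom[OF assms(1,2)]]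
  by simp

definition unit :: "'o1 \<Rightarrow> 'm1" where
  "unit X = \<phi> X (FObj L X) (Ident D (FObj L X))"

lemma unit_hom: "X \<in> Obj C \<Longrightarrow> unit X \<in> homset C X (FObj R (FObj L X))"
  unfolding unit_def by (intro transpose_hom D.Ident_hom L.FObj_Obj)

lemma transpose_eq_unit:
  assumes "X \<in> Obj C" "h \<in> homset D (FObj L X) Y"
  shows "\<phi> X Y h = FArr R h \<cdot>\<^bsub>C\<^esub> unit X"
  unfolding unit_def
  using transpose_Comp_right[OF assms(1) D.Ident_hom[OF L.FObj_Obj[OF assms(1)]] assms(2)]
    D.Comp_Ident[OF assms(2)] by simp

text \<open>A natural bijection need not be additive by definition; zero is preserved because
  \<open>\<phi>\<close> is application of the additive functor \<open>R\<close> followed by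
  composition with the unit.\<close>

lemma transpose_Zero:
  assumes "X \<in> Obj C" "Y \<in> Obj D"
  shows "\<phi> X Y (ZeroArr D (FObj L X) Y) = ZeroArr C X (FObj R Y)"
  using transpose_eq_unit[OF assms(1) D.ZeroArr_hom[OF L.FObj_Obj[OF assms(1)] assms(2)]]
    C.Zero_Comp[OF unit_hom[OF assms(1)] R.FObj_Obj[OF assms(2)]]
    FArr_ZeroArr[OF D.preadditive_category_axioms C.preadditive_category_axioms
      R.additive_functor_axioms L.FObj_Obj[OF assms(1)] assms(2)]
  by simp

text \<open>Reversing arrows turns \<open>R\<close> into the left adjoint, with transposition
  inverse to \<open>\<phi>\<close>. Naturality of the inverse is checked after applying the
  injective map \<open>\<phi>\<close>.\<close>

lemma op_cat_adjunction:
  "additive_adjunction (op_cat D) (op_cat C) R L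
    (\<lambda>Y X. inv_into (homset D (FObj L X) Y) (\<phi> X Y))"
proof (intro additive_adjunction.intro additive_adjunction_axioms.intro additive_functor_op_cat
    C.preadditive_op_cat D.preadditive_op_cat L.additive_functor_axioms R.additive_functor_axioms)
  let ?\<theta> = "\<lambda>Y X. inv_into (homset D (FObj L X) Y) (\<phi> X Y)"
  have \<theta>: "?\<theta> Y X h \<in> homset D (FObj L X) Y" "\<phi> X Y (?\<theta> Y X h) = h"
    if "Y \<in> Obj D" "h \<in> homset C X (FObj R Y)" for X Y h
  proof -
    have "h \<in> \<phi> X Y ` homset D (FObj L X) Y" using transpose_surj[OF that] by auto
    then show "?\<theta> Y X h \<in> homset D (FObj L X) Y" "\<phi> X Y (?\<theta> Y X h) = h"
      by (rule inv_into_into, rule f_inv_into_f)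
  qed
  have "?\<theta> Y' X' ((FArr R f \<cdot>\<^bsub>C\<^esub> h) \<cdot>\<^bsub>C\<^esub> g) = (f \<cdot>\<^bsub>D\<^esub> ?\<theta> Y X h) \<cdot>\<^bsub>D\<^esub> FArr L g"
    if f: "f \<in> homset D Y Y'" and h: "h \<in> homset C X (FObj R Y)" and g: "g \<in> homset C X' X"
    for X X' Y Y' f g h
  proof -
    note o = C.homset_Obj[OF g] D.homset_Obj[OF f]
    note t = \<theta>[OF o(3) h]
    have "\<phi> X' Y' ((f \<cdot>\<^bsub>D\<^esub> ?\<theta> Y X h) \<cdot>\<^bsub>D\<^esub> FArr L g) = (FArr R f \<cdot>\<^bsub>C\<^esub> h) \<cdot>\<^bsub>C\<^esub> g"
      using transpose_Comp_left[OF g D.Comp_hom[OF t(1) f]] transpose_Comp_right[OF o(2) t(1) f] t(2)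
      by simp
    moreover have "(f \<cdot>\<^bsub>D\<^esub> ?\<theta> Y X h) \<cdot>\<^bsub>D\<^esub> FArr L g \<in> homset D (FObj L X') Y'"
      using D.Comp_hom[OF L.FArr_hom[OF g] D.Comp_hom[OF t(1) f]] .
    ultimately show ?thesis
      by (intro inv_into_f_eq[OF bij_betw_imp_inj_on[OF bij_hom[OF o(1,4)]]])
  qed
  then show "adjunction (op_cat D) (op_cat C) R L ?\<theta>"
    unfolding adjunction_def using bij_betw_inv_into[OF bij_hom] by auto
qed

text \<open>Transposition turns composition with \<open>FArr L e\<close> into composition with
  \<open>e\<close>, where cancellation is available.\<close>

lemma left_adjoint_epi:
  assumes "epi_arr C e"
  shows "epi_arr D (FArr L e)"
proof -
  define X Y where "X = Dom C e" and "Y = Cod C e"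
  have e: "e \<in> homset C X Y"
    using assms by (simp add: epi_arr_def homset_def X_def Y_def)
  show ?thesis
  proof (rule epi_arrI[OF L.FArr_hom[OF e]])
    fix Z g h
    assume gh: "g \<in> homset D (FObj L Y) Z" "h \<in> homset D (FObj L Y) Z"
      "g \<cdot>\<^bsub>D\<^esub> FArr L e = h \<cdot>\<^bsub>D\<^esub> FArr L e"
    then have "\<phi> Y Z g \<cdot>\<^bsub>C\<^esub> e = \<phi> Y Z h \<cdot>\<^bsub>C\<^esub> e"
      using transpose_Comp_left[OF e gh(1)] transpose_Comp_left[OF e gh(2)] by simp
    then have "\<phi> Y Z g = \<phi> Y Z h"
      using epi_arrD[OF assms e] transpose_hom gh(1,2) C.homset_Obj[OF e] by blast
    then show "g = h" using transpose_inj gh(1,2) C.homset_Obj[OF e] by blast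
  qed
qed

text \<open>By naturality, composing with \<open>unit X\<close> is \<open>FArr L\<close> followed by
  transposition, hence bijective when \<open>L\<close> is fully faithful; this inverts the
  unit.\<close>

lemma fully_faithful_unit:
  assumes ff: "fully_faithful C D L" and X: "X \<in> Obj C"
  shows "\<exists>r \<in> homset C (FObj R (FObj L X)) X.
    r \<cdot>\<^bsub>C\<^esub> unit X = Ident C X \<and> unit X \<cdot>\<^bsub>C\<^esub> r = Ident C (FObj R (FObj L X))"
proof -
  let ?T = "FObj R (FObj L X)"
  have T: "?T \<in> Obj C" using X L.FObj_Obj R.FObj_Obj by blast
  have nat: "\<phi> Y (FObj L X) (FArr L f) = unit X \<cdot>\<^bsub>C\<^esub> f" if "f \<in> homset C Y X" for f Y
    unfolding unit_def using transpose_Comp_left[OF that D.Ident_hom[OF L.FObj_Obj[OF X]]]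
      D.Ident_Comp[OF L.FArr_hom[OF that]] by simp
  have bij: "bij_betw (FArr L) (homset C Y X) (homset D (FObj L Y) (FObj L X))"
    if "Y \<in> Obj C" for Y
    using ff X that by (simp add: fully_faithful_def)
  \<comment> \<open>Here \<open>g\<close> is the counit at \<open>FObj L X\<close>; its preimage
    \<open>r\<close> under the full functor \<open>L\<close> is the inverse sought.\<close>
  obtain g where g: "g \<in> homset D (FObj L ?T) (FObj L X)" "\<phi> ?T (FObj L X) g = Ident C ?T"
    using transpose_surj[OF L.FObj_Obj[OF X] C.Ident_hom[OF T]] by blast
  have "g \<in> FArr L ` homset C ?T X" using bij_betw_imp_surj_on[OF bij[OF T]] g(1) by simp
  then obtain r where r: "r \<in> homset C ?T X" "FArr L r = g" by (rule imageE) simp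
  have ur: "unit X \<cdot>\<^bsub>C\<^esub> r = Ident C ?T" using nat[OF r(1)] r(2) g(2) by simp
  have ru: "r \<cdot>\<^bsub>C\<^esub> unit X \<in> homset C X X" using C.Comp_hom[OF unit_hom[OF X] r(1)] .
  have "unit X \<cdot>\<^bsub>C\<^esub> (r \<cdot>\<^bsub>C\<^esub> unit X) = unit X \<cdot>\<^bsub>C\<^esub> Ident C X"
    using C.Comp_assoc[OF unit_hom[OF X] r(1) unit_hom[OF X]] ur
      C.Ident_Comp[OF unit_hom[OF X]] C.Comp_Ident[OF unit_hom[OF X]] by simp
  then have "FArr L (r \<cdot>\<^bsub>C\<^esub> unit X) = FArr L (Ident C X)"
    using nat[OF ru] nat[OF C.Ident_hom[OF X]]
      transpose_inj[OF X L.FArr_hom[OF ru] L.FArr_hom[OF C.Ident_hom[OF X]]] by simp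
  then have "r \<cdot>\<^bsub>C\<^esub> unit X = Ident C X"
    using inj_onD[OF bij_betw_imp_inj_on[OF bij[OF X]] _ ru C.Ident_hom[OF X]] by simp
  then show ?thesis using r ur by blast
qed

end

section \<open>Bricks\<close>

text \<open>The pairwise condition of \<open>epibrick\<close>, isolated so that it can be
  transported along isomorphisms and checked one ordered pair at a time.\<close>

definition epi_or_zero :: "('o, 'm, 'z) preadd_cat_scheme \<Rightarrow> 'o \<Rightarrow> 'o \<Rightarrow> bool" where
  "epi_or_zero C X Y \<longleftrightarrow> (\<forall>f \<in> homset C X Y. f = ZeroArr C X Y \<or> epi_arr C f)"

context preadditive_category
begin

lemma ring_End_ring:
  assumes "X \<in> Obj C"
  shows "ring (End_ring C X)"
proof (rule ringI)
  have "comm_group (add_monoid (End_ring C X))"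
    using hom_comm_group[OF assms assms] by (simp add: End_ring_def hom_group_def)
  then show "abelian_group (End_ring C X)"
    by (intro abelian_group.intro abelian_monoid.intro abelian_group_axioms.intro comm_group.axioms(1))
  show "Group.monoid (End_ring C X)"
    by (rule monoidI)
      (auto simp: End_ring_def Ident_hom[OF assms] Ident_Comp Comp_Ident Comp_assoc intro: Comp_hom)
qed (auto simp: End_ring_def Comp_Add Add_Comp)

text \<open>The ring condition equates the units with the nonzero endomorphisms. That zero is no
  unit amounts to the identity being nonzero, since composites with zero vanish.\<close>

lemma brick_iff:
  "brick C X \<longleftrightarrow> X \<in> Obj C \<and> Ident C X \<noteq> ZeroArr C X X \<and>
    (\<forall>f \<in> homset C X X. f \<noteq> ZeroArr C X X \<longrightarrow>
      (\<exists>g \<in> homset C X X. g \<cdot> f = Ident C X \<and> f \<cdot> g = Ident C X))"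
proof (cases "X \<in> Obj C")
  case True
  have "brick C X \<longleftrightarrow> {f \<in> homset C X X. \<exists>g \<in> homset C X X. g \<cdot> f = Ident C X \<and> f \<cdot> g = Ident C X}
      = homset C X X - {ZeroArr C X X}"
    using True ring_End_ring[OF True]
    by (simp add: brick_def division_ring_def Units_def End_ring_def)
  also have "\<dots> \<longleftrightarrow> Ident C X \<noteq> ZeroArr C X X \<and>
    (\<forall>f \<in> homset C X X. f \<noteq> ZeroArr C X X \<longrightarrow>
      (\<exists>g \<in> homset C X X. g \<cdot> f = Ident C X \<and> f \<cdot> g = Ident C X))"
    using Ident_hom[OF True] Ident_Comp[OF Ident_hom[OF True]] Comp_Zero[OF _ True] by auto
  finally show ?thesis using True by simp
qed (simp add: brick_def)

lemma brick_op_cat: "brick (op_cat C) X \<longleftrightarrow> brick C X"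
  unfolding brick_iff preadditive_category.brick_iff[OF preadditive_op_cat] by auto

text \<open>An endomorphism of \<open>Y\<close> is conjugated to \<open>X\<close>, inverted there,
  and the inverse is conjugated back.\<close>

lemma brick_isomorphic:
  assumes "isomorphic C X Y" "brick C X"
  shows "brick C Y"
proof -
  obtain a b where a: "a \<in> homset C X Y" and b: "b \<in> homset C Y X"
    and ba: "b \<cdot> a = Ident C X" and ab: "a \<cdot> b = Ident C Y"
    and X: "X \<in> Obj C" and Y: "Y \<in> Obj C"
    using assms(1) unfolding isomorphic_def by blast
  have "Ident C Y \<noteq> ZeroArr C Y Y"
  proof
    assume "Ident C Y = ZeroArr C Y Y"
    then have "b \<cdot> a = ZeroArr C X X"
      using Ident_Zero_imp'[OF _ a] Comp_Zero[OF b X] by simp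
    then show False using ba assms(2) brick_iff by simp
  qed
  moreover have "\<exists>g \<in> homset C Y Y. g \<cdot> f = Ident C Y \<and> f \<cdot> g = Ident C Y"
    if f: "f \<in> homset C Y Y" "f \<noteq> ZeroArr C Y Y" for f
  proof -
    define f' where "f' = b \<cdot> (f \<cdot> a)"
    have fa: "f \<cdot> a \<in> homset C X Y" using Comp_hom[OF a f(1)] .
    have f': "f' \<in> homset C X X" using Comp_hom[OF fa b] by (simp add: f'_def)
    have af': "a \<cdot> f' = f \<cdot> a" using retract_cancel[OF fa b a ab] by (simp add: f'_def)
    have fe: "f = (f \<cdot> a) \<cdot> b" using Comp_assoc[OF b a f(1)] ab Comp_Ident[OF f(1)] by simp
    have f'b: "f' \<cdot> b = b \<cdot> f" using Comp_assoc[OF b fa b] fe by (simp add: f'_def)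
    have "f' \<noteq> ZeroArr C X X"
      using af' fe f(2) Comp_Zero[OF a X] Zero_Comp[OF b Y] by auto
    then obtain g where g: "g \<in> homset C X X" "g \<cdot> f' = Ident C X" "f' \<cdot> g = Ident C X"
      using assms(2) f' unfolding brick_iff by blast
    have gb: "g \<cdot> b \<in> homset C Y X" using Comp_hom[OF b g(1)] .
    have "(a \<cdot> (g \<cdot> b)) \<cdot> f = a \<cdot> (g \<cdot> (f' \<cdot> b))"
      using Comp_assoc[OF f(1) gb a] Comp_assoc[OF f(1) b g(1)] f'b by simp
    also have "\<dots> = Ident C Y" using retract_cancel[OF b f' g(1,2)] ab by simp
    finally have 1: "(a \<cdot> (g \<cdot> b)) \<cdot> f = Ident C Y" .
    have "f \<cdot> (a \<cdot> (g \<cdot> b)) = a \<cdot> (f' \<cdot> (g \<cdot> b))"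
      using Comp_assoc[OF gb a f(1)] Comp_assoc[OF gb f' a] af' by simp
    also have "\<dots> = Ident C Y" using retract_cancel[OF b g(1) f' g(3)] ab by simp
    finally show ?thesis using 1 Comp_hom[OF gb a] by blast
  qed
  ultimately show ?thesis using brick_iff Y by blast
qed

lemma iso_classes_op_cat: "iso_classes (op_cat C) = iso_classes C"
  by (simp add: iso_classes_def)

text \<open>The bridge by which results on epibricks are converted into results on
  monobricks.\<close>

lemma epibrick_op_cat: "epibrick (op_cat C) S \<longleftrightarrow> monobrick C S"
  unfolding epibrick_def monobrick_def iso_classes_op_cat brick_op_cat homset_op_cat
    op_cat_simps epi_arr_op_cat by blast

text \<open>The arrow \<open>f\<close> is recovered from its conjugate \<open>g\<close> as
  \<open>c \<cdot> g \<cdot> b\<close>, where \<open>c\<close> and \<open>b\<close> are split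
  epimorphisms.\<close>

lemma epi_or_zero_isomorphic:
  assumes "isomorphic C X X'" "isomorphic C Y Y'" "epi_or_zero C X Y"
  shows "epi_or_zero C X' Y'"
  unfolding epi_or_zero_def
proof
  fix f assume f: "f \<in> homset C X' Y'"
  obtain a b where a: "a \<in> homset C X X'" and b: "b \<in> homset C X' X"
    and ba: "b \<cdot> a = Ident C X" and ab: "a \<cdot> b = Ident C X'"
    using assms(1) unfolding isomorphic_def by blast
  obtain c d where c: "c \<in> homset C Y Y'" and d: "d \<in> homset C Y' Y"
    and cd: "c \<cdot> d = Ident C Y'"
    using assms(2) unfolding isomorphic_def by blast
  define g where "g = d \<cdot> (f \<cdot> a)"
  have fa: "f \<cdot> a \<in> homset C X Y'" using Comp_hom[OF a f] .
  have g: "g \<in> homset C X Y" using Comp_hom[OF fa d] by (simp add: g_def)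
  have feq: "f = (c \<cdot> g) \<cdot> b"
    using retract_cancel[OF fa d c cd] Comp_assoc[OF b a f] ab Comp_Ident[OF f] by (simp add: g_def)
  consider "g = ZeroArr C X Y" | "epi_arr C g"
    using assms(3) g unfolding epi_or_zero_def by blast
  then show "f = ZeroArr C X' Y' \<or> epi_arr C f"
  proof cases
    case 1
    then show ?thesis using feq Comp_Zero[OF c] Zero_Comp[OF b] homset_Obj a c by metis
  next
    case 2
    have "epi_arr C (c \<cdot> g)" using epi_arr_Comp[OF 2 split_epi_arr[OF c d cd] g c] .
    then show ?thesis
      using epi_arr_Comp[OF split_epi_arr[OF b a ba] _ b Comp_hom[OF g c]] feq by simp
  qed
qed

text \<open>The conditions of \<open>epibrick\<close> range over all members of the classes; being
  invariant under isomorphism, they need checking only on the representatives in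
  \<open>T\<close>.\<close>

lemma epibrick_iso_classes:
  assumes "\<And>X. X \<in> T \<Longrightarrow> brick C X" "\<And>X Y. \<lbrakk>X \<in> T; Y \<in> T\<rbrakk> \<Longrightarrow> epi_or_zero C X Y"
  shows "epibrick C ((\<lambda>X. {Y. isomorphic C X Y}) ` T)"
  unfolding epibrick_def
proof (intro conjI ballI)
  show "(\<lambda>X. {Y. isomorphic C X Y}) ` T \<subseteq> iso_classes C"
    using assms(1) by (auto simp: iso_classes_def quotient_def brick_def)
next
  fix X assume "X \<in> \<Union> ((\<lambda>X. {Y. isomorphic C X Y}) ` T)"
  then show "brick C X" using assms(1) brick_isomorphic by blast
next
  fix X Y f assume "X \<in> \<Union> ((\<lambda>X. {Y. isomorphic C X Y}) ` T)"
    "Y \<in> \<Union> ((\<lambda>X. {Y. isomorphic C X Y}) ` T)" and f: "f \<in> homset C X Y"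
  then have "epi_or_zero C X Y" using assms(2) epi_or_zero_isomorphic by blast
  then show "f = ZeroArr C X Y \<or> epi_arr C f" using f unfolding epi_or_zero_def by blast
qed

lemma epibrickD:
  assumes "epibrick C S"
  shows "X \<in> \<Union>S \<Longrightarrow> brick C X" "X \<in> \<Union>S \<Longrightarrow> X \<in> Obj C"
    "\<lbrakk>X \<in> \<Union>S; Y \<in> \<Union>S\<rbrakk> \<Longrightarrow> epi_or_zero C X Y"
  using assms unfolding epibrick_def brick_def epi_or_zero_def by blast+

end

lemma ftr_image_eq: "ftr_image D F S = (\<lambda>X. {Y. isomorphic D X Y}) ` FObj F ` \<Union>S"
  unfolding ftr_image_def by blast

lemma ftr_image_op_cat: "ftr_image (op_cat D) F S = ftr_image D F S"
  by (simp add: ftr_image_def)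

text \<open>Every arrow between values of \<open>F\<close> comes from \<open>C\<close>, where the
  epibrick condition and inverses are available. The conclusions are kept at the level of objects
  and pairs so that they also serve inside a union.\<close>

lemma fully_faithful_epibrick:
  assumes "preadditive_category C" "preadditive_category D" "additive_functor C D F"
    and ff: "fully_faithful C D F" and epi: "\<And>f. epi_arr C f \<Longrightarrow> epi_arr D (FArr F f)"
    and S: "epibrick C S"
  shows "X \<in> \<Union>S \<Longrightarrow> brick D (FObj F X)"
    "\<lbrakk>X \<in> \<Union>S; Y \<in> \<Union>S\<rbrakk> \<Longrightarrow> epi_or_zero D (FObj F X) (FObj F Y)"
proof -
  interpret C: preadditive_category C by fact
  interpret D: preadditive_category D by fact
  interpret F: additive_functor C D F by fact
  note Zero = FArr_ZeroArr[OF assms(1-3)]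
  have bij: "bij_betw (FArr F) (homset C X Y) (homset D (FObj F X) (FObj F Y))"
    if "X \<in> Obj C" "Y \<in> Obj C" for X Y
    using ff that by (simp add: fully_faithful_def)
  have full: "\<exists>f' \<in> homset C X Y. f = FArr F f'"
    if "X \<in> Obj C" "Y \<in> Obj C" "f \<in> homset D (FObj F X) (FObj F Y)" for X Y f
    using that(3) unfolding bij_betw_imp_surj_on[OF bij[OF that(1,2)], symmetric] by blast
  note faithful = bij_betw_imp_inj_on[OF bij]
  show "epi_or_zero D (FObj F X) (FObj F Y)" if S': "X \<in> \<Union>S" "Y \<in> \<Union>S"
    unfolding epi_or_zero_def
  proof
    note o = C.epibrickD(2)[OF S S'(1)] C.epibrickD(2)[OF S S'(2)]
    fix f assume "f \<in> homset D (FObj F X) (FObj F Y)"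
    then obtain f' where f': "f' \<in> homset C X Y" "f = FArr F f'" using full[OF o] by blast
    then have "f' = ZeroArr C X Y \<or> epi_arr C f'"
      using C.epibrickD(3)[OF S S'] unfolding epi_or_zero_def by blast
    then show "f = ZeroArr D (FObj F X) (FObj F Y) \<or> epi_arr D f"
      using epi Zero[OF o] f'(2) by auto
  qed
  show "brick D (FObj F X)" if XS: "X \<in> \<Union>S"
  proof -
    note X = C.epibrickD(2)[OF S XS]
    have "Ident D (FObj F X) \<noteq> ZeroArr D (FObj F X) (FObj F X)"
      using inj_onD[OF faithful[OF X X] _ C.Ident_hom[OF X] C.ZeroArr_hom[OF X X]]
        F.FArr_Ident[OF X] Zero[OF X X] C.epibrickD(1)[OF S XS] C.brick_iff by auto
    moreover have "\<exists>g \<in> homset D (FObj F X) (FObj F X).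
        g \<cdot>\<^bsub>D\<^esub> f = Ident D (FObj F X) \<and> f \<cdot>\<^bsub>D\<^esub> g = Ident D (FObj F X)"
      if f: "f \<in> homset D (FObj F X) (FObj F X)" "f \<noteq> ZeroArr D (FObj F X) (FObj F X)" for f
    proof -
      obtain f' where f': "f' \<in> homset C X X" "f = FArr F f'" using full[OF X X f(1)] by blast
      then have "f' \<noteq> ZeroArr C X X" using f(2) Zero[OF X X] by auto
      then obtain g where g: "g \<in> homset C X X" "g \<cdot>\<^bsub>C\<^esub> f' = Ident C X" "f' \<cdot>\<^bsub>C\<^esub> g = Ident C X"
        using C.epibrickD(1)[OF S XS] f'(1) unfolding C.brick_iff by blast
      then show ?thesis
        using F.FArr_hom[OF g(1)] F.FArr_Comp[OF f'(1) g(1)] F.FArr_Comp[OF g(1) f'(1)]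
          F.FArr_Ident[OF X] f'(2) by auto
    qed
    ultimately show ?thesis using D.brick_iff F.FObj_Obj[OF X] by blast
  qed
qed

section \<open>Faithfulness on the morphisms from or to an object\<close>

text \<open>For an additive functor, killing no nonzero arrow out of \<open>X\<close> is the same as
  injectivity on each hom set out of \<open>X\<close>.\<close>

definition faithful_from ::
    "('o1, 'm1, 'z1) preadd_cat_scheme \<Rightarrow> ('o2, 'm2, 'z2) preadd_cat_scheme
      \<Rightarrow> ('o1, 'm1, 'o2, 'm2) ftr \<Rightarrow> 'o1 \<Rightarrow> bool" where
  "faithful_from C D F X \<longleftrightarrow> (\<forall>Z. \<forall>h \<in> homset C X Z.
    FArr F h = ZeroArr D (FObj F X) (FObj F Z) \<longrightarrow> h = ZeroArr C X Z)"

definition faithful_to ::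
    "('o1, 'm1, 'z1) preadd_cat_scheme \<Rightarrow> ('o2, 'm2, 'z2) preadd_cat_scheme
      \<Rightarrow> ('o1, 'm1, 'o2, 'm2) ftr \<Rightarrow> 'o1 \<Rightarrow> bool" where
  "faithful_to C D F X \<longleftrightarrow> (\<forall>Z. \<forall>h \<in> homset C Z X.
    FArr F h = ZeroArr D (FObj F Z) (FObj F X) \<longrightarrow> h = ZeroArr C Z X)"

lemma faithful_from_op_cat [simp]: "faithful_from (op_cat C) (op_cat D) F X \<longleftrightarrow> faithful_to C D F X"
  and faithful_to_op_cat [simp]: "faithful_to (op_cat C) (op_cat D) F X \<longleftrightarrow> faithful_from C D F X"
  by (simp_all add: faithful_from_def faithful_to_def)

lemma faithful_fromD:
  "\<lbrakk>faithful_from C D F X; h \<in> homset C X Z; FArr F h = ZeroArr D (FObj F X) (FObj F Z)\<rbrakk>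
    \<Longrightarrow> h = ZeroArr C X Z"
  by (simp add: faithful_from_def)

text \<open>The transpose of \<open>h\<close> is \<open>FArr R h\<close> composed with the unit, so
  it vanishes with \<open>FArr R h\<close>, and transposition is injective.\<close>

lemma (in additive_adjunction) faithful_from_left_adjoint:
  assumes X: "X \<in> Obj C"
  shows "faithful_from D C R (FObj L X)"
  unfolding faithful_from_def
proof (intro allI ballI impI)
  fix Z h
  assume h: "h \<in> homset D (FObj L X) Z" "FArr R h = ZeroArr C (FObj R (FObj L X)) (FObj R Z)"
  have Z: "Z \<in> Obj D" using D.homset_Obj(2)[OF h(1)] .
  have "\<phi> X Z h = \<phi> X Z (ZeroArr D (FObj L X) Z)"
    using transpose_eq_unit[OF X h(1)] h(2) C.Zero_Comp[OF unit_hom[OF X] R.FObj_Obj[OF Z]]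
      transpose_Zero[OF X Z] by simp
  then show "h = ZeroArr D (FObj L X) Z"
    using transpose_inj[OF X h(1) D.ZeroArr_hom[OF L.FObj_Obj[OF X] Z]] by simp
qed

text \<open>The counit is the unit of the opposite adjunction, whose left adjoint is the fully
  faithful \<open>R\<close>.\<close>

lemma (in additive_adjunction) counit_iso:
  assumes ff: "fully_faithful D C R" and Y: "Y \<in> Obj D"
  shows "counit D C L R \<phi> Y \<in> homset D (FObj L (FObj R Y)) Y"
    and "\<exists>r \<in> homset D Y (FObj L (FObj R Y)). counit D C L R \<phi> Y \<cdot>\<^bsub>D\<^esub> r = Ident D Y \<and>
      r \<cdot>\<^bsub>D\<^esub> counit D C L R \<phi> Y = Ident D (FObj L (FObj R Y))"
proof -
  let ?\<theta> = "\<lambda>Y X. inv_into (homset D (FObj L X) Y) (\<phi> X Y)"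
  interpret op: additive_adjunction "op_cat D" "op_cat C" R L ?\<theta> by (rule op_cat_adjunction)
  have RY: "FObj R Y \<in> Obj C" using R.FObj_Obj[OF Y] .
  obtain e where e: "e \<in> homset D (FObj L (FObj R Y)) Y" "\<phi> (FObj R Y) Y e = Ident C (FObj R Y)"
    using transpose_surj[OF Y C.Ident_hom[OF RY]] by blast
  have c: "counit D C L R \<phi> Y = e"
    unfolding counit_def
  proof (rule the_equality)
    fix e' assume "e' \<in> homset D (FObj L (FObj R Y)) Y \<and> \<phi> (FObj R Y) Y e' = Ident C (FObj R Y)"
    then show "e' = e" using transpose_inj[OF RY _ e(1)] e(2) by simp
  qed (use e in simp)
  have "?\<theta> Y (FObj R Y) (Ident C (FObj R Y)) = e"
    by (rule inv_into_f_eq[OF bij_betw_imp_inj_on[OF bij_hom[OF RY Y]] e])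
  then have "op.unit Y = e" by (simp add: op.unit_def)
  then have "\<exists>r \<in> homset D Y (FObj L (FObj R Y)).
      e \<cdot>\<^bsub>D\<^esub> r = Ident D Y \<and> r \<cdot>\<^bsub>D\<^esub> e = Ident D (FObj L (FObj R Y))"
    using op.fully_faithful_unit[of Y] ff Y by (simp add: fully_faithful_op_cat)
  then show "counit D C L R \<phi> Y \<in> homset D (FObj L (FObj R Y)) Y"
    "\<exists>r \<in> homset D Y (FObj L (FObj R Y)). counit D C L R \<phi> Y \<cdot>\<^bsub>D\<^esub> r = Ident D Y \<and>
      r \<cdot>\<^bsub>D\<^esub> counit D C L R \<phi> Y = Ident D (FObj L (FObj R Y))"
    using e(1) c by simp_all
qed

text \<open>An arrow \<open>h\<close> out of the quotient \<open>Y\<close> is tested on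
  \<open>h \<cdot> e\<close>, and then \<open>e\<close> is cancelled.\<close>

lemma faithful_from_epi:
  assumes "preadditive_category C" "preadditive_category D" "additive_functor C D F"
    and X: "faithful_from C D F X" and e: "e \<in> homset C X Y" "epi_arr C e"
  shows "faithful_from C D F Y"
  unfolding faithful_from_def
proof (intro allI ballI impI)
  interpret C: preadditive_category C by fact
  interpret D: preadditive_category D by fact
  interpret F: additive_functor C D F by fact
  fix Z h assume h: "h \<in> homset C Y Z" "FArr F h = ZeroArr D (FObj F Y) (FObj F Z)"
  have "FArr F (h \<cdot>\<^bsub>C\<^esub> e) = ZeroArr D (FObj F X) (FObj F Z)"
    using F.FArr_Comp[OF e(1) h(1)] h(2)
      D.Zero_Comp[OF F.FArr_hom[OF e(1)] F.FObj_Obj[OF C.homset_Obj(2)[OF h(1)]]] by simp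
  then have "h \<cdot>\<^bsub>C\<^esub> e = ZeroArr C X Z"
    using faithful_fromD[OF X C.Comp_hom[OF e(1) h(1)]] by simp
  then show "h = ZeroArr C Y Z" using C.epi_arrD_Zero[OF e(2,1) h(1)] by simp
qed

lemma faithful_to_mono:
  assumes "preadditive_category C" "preadditive_category D" "additive_functor C D F"
    and "faithful_to C D F Y" "m \<in> homset C X Y" "mono_arr C m"
  shows "faithful_to C D F X"
  using faithful_from_epi[OF assms(1,2)[THEN preadditive_category.preadditive_op_cat]
      additive_functor_op_cat[OF assms(3)], of Y m X] assms(4-6) by simp

text \<open>If \<open>h \<cdot> f\<close> vanishes, cancelling \<open>FArr F f\<close> in its image
  shows that \<open>FArr F h\<close> vanishes, and faithfulness at \<open>Y\<close> applies.\<close>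

lemma faithful_from_reflects_epi:
  assumes "preadditive_category C" "preadditive_category D" "additive_functor C D F"
    and Y: "faithful_from C D F Y" and f: "f \<in> homset C X Y" "epi_arr D (FArr F f)"
  shows "epi_arr C f"
proof -
  interpret C: preadditive_category C by fact
  interpret D: preadditive_category D by fact
  interpret F: additive_functor C D F by fact
  show ?thesis
  proof (rule C.epi_arrI_Zero[OF f(1)])
    fix Z h assume h: "h \<in> homset C Y Z" "h \<cdot>\<^bsub>C\<^esub> f = ZeroArr C X Z"
    have "FArr F h \<cdot>\<^bsub>D\<^esub> FArr F f = ZeroArr D (FObj F X) (FObj F Z)"
      using F.FArr_Comp[OF f(1) h(1)] h(2)
        FArr_ZeroArr[OF assms(1-3) C.homset_Obj(1)[OF f(1)] C.homset_Obj(2)[OF h(1)]] by simp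
    then have "FArr F h = ZeroArr D (FObj F Y) (FObj F Z)"
      by (rule D.epi_arrD_Zero[OF f(2) F.FArr_hom[OF f(1)] F.FArr_hom[OF h(1)]])
    then show "h = ZeroArr C Y Z" using faithful_fromD[OF Y h(1)] by simp
  qed
qed

lemma faithful_to_reflects_mono:
  assumes "preadditive_category C" "preadditive_category D" "additive_functor C D F"
    and "faithful_to C D F X" "f \<in> homset C X Y" "mono_arr D (FArr F f)"
  shows "mono_arr C f"
  using faithful_from_reflects_epi[OF assms(1,2)[THEN preadditive_category.preadditive_op_cat]
      additive_functor_op_cat[OF assms(3)], of X f Y] assms(4-6) by simp

text \<open>Faithfulness at the source reflects zero arrows, faithfulness at the target reflects
  epimorphisms.\<close>

lemma faithful_from_epi_or_zero:
  assumes "preadditive_category C" "preadditive_category D" "additive_functor C D F"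
    and X: "faithful_from C D F X" and Y: "faithful_from C D F Y"
    and XY: "epi_or_zero D (FObj F X) (FObj F Y)"
  shows "epi_or_zero C X Y"
  unfolding epi_or_zero_def
proof
  interpret F: additive_functor C D F by fact
  fix f assume f: "f \<in> homset C X Y"
  then have "FArr F f = ZeroArr D (FObj F X) (FObj F Y) \<or> epi_arr D (FArr F f)"
    using XY F.FArr_hom unfolding epi_or_zero_def by blast
  then show "f = ZeroArr C X Y \<or> epi_arr C f"
    using faithful_fromD[OF X f] faithful_from_reflects_epi[OF assms(1-3) Y f] by blast
qed

text \<open>The image of a nonzero endomorphism is nonzero, hence invertible. Being mono and epi is
  reflected to \<open>C\<close>, where balancedness supplies the inverse.\<close>

lemma faithful_brick:
  assumes "abelian_category C" "preadditive_category D" "additive_functor C D F"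
    and fX: "faithful_from C D F X" and tX: "faithful_to C D F X"
    and X: "X \<in> Obj C" and FX: "brick D (FObj F X)"
  shows "brick C X"
proof -
  interpret C: abelian_category C by fact
  interpret D: preadditive_category D by fact
  interpret F: additive_functor C D F by fact
  note pre = C.preadditive_category_axioms D.preadditive_category_axioms F.additive_functor_axioms
  have "Ident C X \<noteq> ZeroArr C X X"
    using FArr_ZeroArr[OF pre X X] F.FArr_Ident[OF X] FX unfolding D.brick_iff by auto
  moreover have "\<exists>g \<in> homset C X X. g \<cdot>\<^bsub>C\<^esub> f = Ident C X \<and> f \<cdot>\<^bsub>C\<^esub> g = Ident C X"
    if f: "f \<in> homset C X X" "f \<noteq> ZeroArr C X X" for f
  proof -
    have Ff: "FArr F f \<in> homset D (FObj F X) (FObj F X)" using F.FArr_hom[OF f(1)] .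
    have "FArr F f \<noteq> ZeroArr D (FObj F X) (FObj F X)" using faithful_fromD[OF fX f(1)] f(2) by blast
    then obtain g where g: "g \<in> homset D (FObj F X) (FObj F X)"
      "g \<cdot>\<^bsub>D\<^esub> FArr F f = Ident D (FObj F X)" "FArr F f \<cdot>\<^bsub>D\<^esub> g = Ident D (FObj F X)"
      using FX Ff unfolding D.brick_iff by blast
    have "epi_arr D (FArr F f)" using D.split_epi_arr[OF Ff g(1,3)] .
    moreover have "mono_arr D (FArr F f)" using D.split_mono_arr[OF Ff g(1,2)] .
    ultimately show ?thesis
      using C.mono_epi_imp_iso[OF f(1)] faithful_from_reflects_epi[OF pre fX f(1)]
        faithful_to_reflects_mono[OF pre tX f(1)] by blast
  qed
  ultimately show ?thesis using C.brick_iff X by blast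
qed

section \<open>Recollements\<close>

lemma ex_additive_adjunction:
  "\<lbrakk>preadditive_category C; preadditive_category D; additive_functor C D L; additive_functor D C R;
    adjoint_pair C D L R\<rbrakk> \<Longrightarrow> \<exists>\<phi>. additive_adjunction C D L R \<phi>"
  by (auto simp: adjoint_pair_def additive_adjunction_def additive_adjunction_axioms_def)

lemma adjoint_pair_preserves_epi:
  assumes "preadditive_category C" "preadditive_category D" "additive_functor C D L"
    "additive_functor D C R" "adjoint_pair C D L R" "epi_arr C f"
  shows "epi_arr D (FArr L f)"
proof -
  obtain \<phi> where "additive_adjunction C D L R \<phi>" using ex_additive_adjunction[OF assms(1-5)] by blast
  then show ?thesis using assms(6) by (rule additive_adjunction.left_adjoint_epi)
qed

lemma adjoint_pair_faithful_from:
  assumes "preadditive_category C" "preadditive_category D" "additive_functor C D L"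
    "additive_functor D C R" "adjoint_pair C D L R" "X \<in> Obj C"
  shows "faithful_from D C R (FObj L X)"
proof -
  obtain \<phi> where "additive_adjunction C D L R \<phi>" using ex_additive_adjunction[OF assms(1-5)] by blast
  then show ?thesis using assms(6) by (rule additive_adjunction.faithful_from_left_adjoint)
qed

lemma adjoint_pair_op_cat:
  assumes "preadditive_category C" "preadditive_category D" "additive_functor C D L"
    "additive_functor D C R" "adjoint_pair C D L R"
  shows "adjoint_pair (op_cat D) (op_cat C) R L"
proof -
  obtain \<phi> where "additive_adjunction C D L R \<phi>" using ex_additive_adjunction[OF assms] by blast
  then show ?thesis
    using additive_adjunction.adjunction[OF additive_adjunction.op_cat_adjunction]
    unfolding adjoint_pair_def by blast
qed

text \<open>The objects \<open>M\<close> of \<open>D\<close> are extended along \<open>F\<close> to objects \<open>G M\<close> without nonzero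
  subobjects or quotients in the kernel of \<open>F\<close>; for \<open>F = j\<^sup>*\<close> this determines
  \<open>G M\<close> up to isomorphism as \<open>j\<^sub>!\<^sub>* M\<close>.\<close>

definition intermediate_section ::
    "('o, 'm, 'z) preadd_cat_scheme \<Rightarrow> ('o2, 'm2, 'z2) preadd_cat_scheme
      \<Rightarrow> ('o, 'm, 'o2, 'm2) ftr \<Rightarrow> ('o2, 'm2, 'o, 'm) ftr \<Rightarrow> bool" where
  "intermediate_section C D F G \<longleftrightarrow> (\<forall>M \<in> Obj D. FObj G M \<in> Obj C \<and>
    isomorphic D M (FObj F (FObj G M)) \<and>
    faithful_from C D F (FObj G M) \<and> faithful_to C D F (FObj G M))"

lemma intermediate_section_op_cat:
  "intermediate_section (op_cat C) (op_cat D) F G \<longleftrightarrow> intermediate_section C D F G"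
  by (auto simp: intermediate_section_def)

sublocale recollement \<subseteq> A': abelian_category A' by (rule abelian)
sublocale recollement \<subseteq> A: abelian_category A by (rule abelian)
sublocale recollement \<subseteq> A'': abelian_category A'' by (rule abelian)
sublocale recollement \<subseteq> i_ups: additive_functor A A' i_ups by (rule additive)
sublocale recollement \<subseteq> i_dns: additive_functor A' A i_dns by (rule additive)
sublocale recollement \<subseteq> i_upx: additive_functor A A' i_upx by (rule additive)
sublocale recollement \<subseteq> j_dnx: additive_functor A'' A j_dnx by (rule additive)
sublocale recollement \<subseteq> j_ups: additive_functor A A'' j_ups by (rule additive)
sublocale recollement \<subseteq> j_dns: additive_functor A'' A j_dns by (rule additive)

section \<open>The opposite recollement and the behaviour of \<open>j_ups\<close>\<close>

context recollement
begin

lemmas preadditive = A'.preadditive_category_axioms A.preadditive_category_axioms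
  A''.preadditive_category_axioms

lemmas j_ups_additive = preadditive(2,3) additive(5)

text \<open>Duality exchanges \<open>i_ups\<close> with \<open>i_upx\<close> and
  \<open>j_dnx\<close> with \<open>j_dns\<close>, while \<open>i_dns\<close> and
  \<open>j_ups\<close> stay in place.\<close>

lemma recollement_op_cat:
  "recollement (op_cat A') (op_cat A) (op_cat A'') i_upx i_dns i_ups j_dns j_ups j_dnx"
proof (rule recollement.intro)
  show "Ker_obj (op_cat A) (op_cat A'') j_ups = ess_image (op_cat A') (op_cat A) i_dns"
    using Ker_eq_ess_image by (simp add: Ker_obj_def ess_image_def)
qed (simp_all add: A'.abelian_op_cat A.abelian_op_cat A''.abelian_op_cat additive_functor_op_cat
    additive adjoint_pair_op_cat preadditive adjoint fully_faithful_op_cat full_faithful)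

lemma i_dns_preserves_epi: "epi_arr A' f \<Longrightarrow> epi_arr A (FArr i_dns f)"
  by (rule adjoint_pair_preserves_epi[OF preadditive(1,2) additive(2,3) adjoint(2)])

lemma j_dnx_preserves_epi: "epi_arr A'' f \<Longrightarrow> epi_arr A (FArr j_dnx f)"
  by (rule adjoint_pair_preserves_epi[OF preadditive(3,2) additive(4,5) adjoint(3)])

lemma j_ups_preserves_epi: "epi_arr A f \<Longrightarrow> epi_arr A'' (FArr j_ups f)"
  by (rule adjoint_pair_preserves_epi[OF preadditive(2,3) additive(5,6) adjoint(4)])

text \<open>As right adjoint of \<open>j_dnx\<close>, the functor \<open>j_ups\<close> becomes a
  left adjoint in the opposite recollement.\<close>

lemma j_ups_preserves_mono: "mono_arr A f \<Longrightarrow> mono_arr A'' (FArr j_ups f)"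
  using recollement.j_ups_preserves_epi[OF recollement_op_cat] by simp

lemma faithful_from_j_dnx: "M \<in> Obj A'' \<Longrightarrow> faithful_from A A'' j_ups (FObj j_dnx M)"
  by (rule adjoint_pair_faithful_from[OF preadditive(3,2) additive(4,5) adjoint(3)])

lemma faithful_to_j_dns: "M \<in> Obj A'' \<Longrightarrow> faithful_to A A'' j_ups (FObj j_dns M)"
  using recollement.faithful_from_j_dnx[OF recollement_op_cat] by simp

lemma isomorphic_j_ups_j_dnx:
  assumes "M \<in> Obj A''"
  shows "isomorphic A'' M (FObj j_ups (FObj j_dnx M))"
proof -
  obtain \<phi> where "additive_adjunction A'' A j_dnx j_ups \<phi>"
    using ex_additive_adjunction[OF preadditive(3,2) additive(4,5) adjoint(3)] by blast
  then interpret j: additive_adjunction A'' A j_dnx j_ups \<phi> .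
  show ?thesis
    using j.fully_faithful_unit[OF full_faithful(2) assms] j.unit_hom[OF assms] assms
      j_ups.FObj_Obj[OF j_dnx.FObj_Obj[OF assms]] unfolding isomorphic_def by blast
qed

lemma zero_object_j_ups_i_dns:
  "B \<in> Obj A' \<Longrightarrow> zero_object A'' (FObj j_ups (FObj i_dns B))"
  using Ker_eq_ess_image A.isomorphic_refl i_dns.FObj_Obj unfolding Ker_obj_def ess_image_def
  by blast

text \<open>Since \<open>j_ups\<close> sends the target to a zero object, the image of
  \<open>h\<close> vanishes.\<close>

lemma hom_to_i_dns_zero:
  assumes "faithful_from A A'' j_ups X" "B \<in> Obj A'" "h \<in> homset A X (FObj i_dns B)"
  shows "h = ZeroArr A X (FObj i_dns B)"
  using zero_object_j_ups_i_dns[OF assms(2)]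
  by (intro faithful_fromD[OF assms(1,3)] A''.Ident_Zero_imp'[OF _ j_ups.FArr_hom[OF assms(3)]])
    (simp add: A''.zero_object_iff)

lemma hom_from_i_dns_zero:
  "\<lbrakk>faithful_to A A'' j_ups X; B \<in> Obj A'; h \<in> homset A (FObj i_dns B) X\<rbrakk>
    \<Longrightarrow> h = ZeroArr A (FObj i_dns B) X"
  using recollement.hom_to_i_dns_zero[OF recollement_op_cat, of X B h] by simp

text \<open>The identity of this object transposes to an arrow from \<open>FObj j_dnx M\<close> to a
  value of \<open>i_dns\<close>, and such arrows are zero.\<close>

lemma zero_object_i_ups_j_dnx:
  assumes M: "M \<in> Obj A''"
  shows "zero_object A' (FObj i_ups (FObj j_dnx M))"
proof -
  obtain \<phi> where "additive_adjunction A A' i_ups i_dns \<phi>"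
    using ex_additive_adjunction[OF preadditive(2,1) additive(1,2) adjoint(1)] by blast
  then interpret i: additive_adjunction A A' i_ups i_dns \<phi> .
  let ?X = "FObj j_dnx M" and ?B = "FObj i_ups (FObj j_dnx M)"
  have X: "?X \<in> Obj A" using j_dnx.FObj_Obj[OF M] .
  have B: "?B \<in> Obj A'" using i_ups.FObj_Obj[OF X] .
  have id: "Ident A' ?B \<in> homset A' ?B ?B" using A'.Ident_hom[OF B] .
  have "\<phi> ?X ?B (Ident A' ?B) = ZeroArr A ?X (FObj i_dns ?B)"
    using hom_to_i_dns_zero[OF faithful_from_j_dnx[OF M] B i.transpose_hom[OF X id]] .
  then have "Ident A' ?B = ZeroArr A' ?B ?B"
    using i.transpose_inj[OF X id A'.ZeroArr_hom[OF B B]] i.transpose_Zero[OF X B] by simp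
  then show ?thesis using A'.zero_object_iff B by simp
qed

text \<open>Being killed by \<open>j_ups\<close>, the object is isomorphic to some
  \<open>FObj i_dns B\<close>. That isomorphism is the transpose of an arrow out of
  \<open>FObj i_ups X\<close>, hence zero.\<close>

lemma zero_objectI_Ker:
  assumes X: "X \<in> Obj A" "zero_object A'' (FObj j_ups X)" "zero_object A' (FObj i_ups X)"
  shows "zero_object A X"
proof -
  obtain \<phi> where "additive_adjunction A A' i_ups i_dns \<phi>"
    using ex_additive_adjunction[OF preadditive(2,1) additive(1,2) adjoint(1)] by blast
  then interpret i: additive_adjunction A A' i_ups i_dns \<phi> .
  have "X \<in> ess_image A' A i_dns" using X(1,2) Ker_eq_ess_image unfolding Ker_obj_def by blast
  then obtain B f g where B: "B \<in> Obj A'" and f: "f \<in> homset A (FObj i_dns B) X"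
    and g: "g \<in> homset A X (FObj i_dns B)" "f \<cdot>\<^bsub>A\<^esub> g = Ident A X"
    unfolding ess_image_def isomorphic_def by blast
  obtain h where h: "h \<in> homset A' (FObj i_ups X) B" "\<phi> X B h = g"
    using i.transpose_surj[OF B g(1)] by blast
  have "h = ZeroArr A' (FObj i_ups X) B"
    using A'.Ident_Zero_imp[OF _ h(1)] X(3) A'.zero_object_iff by simp
  then have "g = ZeroArr A X (FObj i_dns B)" using h(2) i.transpose_Zero[OF X(1) B] by simp
  then show ?thesis using g(2) A.Comp_Zero[OF f X(1)] A.zero_object_iff X(1) by simp
qed

text \<open>The image of a morphism to \<open>j\<^sub>! M\<close> killed by \<open>j\<^sup>*\<close> is also killed by \<open>i\<^sup>*\<close>,
  as a subobject of \<open>j\<^sub>! M\<close>.\<close>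

lemma faithful_to_j_dnx:
  assumes exact: "\<And>f. mono_arr A f \<Longrightarrow> mono_arr A' (FArr i_ups f)" and M: "M \<in> Obj A''"
  shows "faithful_to A A'' j_ups (FObj j_dnx M)"
  unfolding faithful_to_def
proof (intro allI ballI impI)
  let ?Y = "FObj j_dnx M"
  fix X h assume h: "h \<in> homset A X ?Y" "FArr j_ups h = ZeroArr A'' (FObj j_ups X) (FObj j_ups ?Y)"
  obtain m where "is_image A h m" using A.ex_image homset_Arr[OF h(1)] by blast
  then obtain I e where e: "e \<in> homset A X I" "epi_arr A e" and m: "m \<in> homset A I ?Y" "mono_arr A m"
    and me: "m \<cdot>\<^bsub>A\<^esub> e = h"
    by (rule A.image_factorization[OF h(1)])
  have I: "I \<in> Obj A" using A.homset_Obj(1)[OF m(1)] .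
  \<comment> \<open>As \<open>j_ups\<close> keeps \<open>e\<close> epic, it kills \<open>m\<close>
    too; keeping \<open>m\<close> monic, it must then kill the image \<open>I\<close>.\<close>
  have "FArr j_ups m \<cdot>\<^bsub>A''\<^esub> FArr j_ups e = ZeroArr A'' (FObj j_ups X) (FObj j_ups ?Y)"
    using j_ups.FArr_Comp[OF e(1) m(1)] me h(2) by simp
  then have jm: "FArr j_ups m = ZeroArr A'' (FObj j_ups I) (FObj j_ups ?Y)"
    by (rule A''.epi_arrD_Zero[OF j_ups_preserves_epi[OF e(2)] j_ups.FArr_hom[OF e(1)]
          j_ups.FArr_hom[OF m(1)]])
  have "zero_object A'' (FObj j_ups I)"
    using A''.zero_object_of_mono[OF j_ups.FArr_hom[OF m(1)] j_ups_preserves_mono[OF m(2)] jm] .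
  \<comment> \<open>By assumption \<open>FArr i_ups m\<close> is monic, and its target is a zero
    object.\<close>
  moreover have "zero_object A' (FObj i_ups I)"
    using zero_object_i_ups_j_dnx[OF M] A'.Ident_Zero_imp'[OF _ i_ups.FArr_hom[OF m(1)]]
    by (intro A'.zero_object_of_mono[OF i_ups.FArr_hom[OF m(1)] exact[OF m(2)]])
      (simp add: A'.zero_object_iff)
  ultimately have "zero_object A I" using zero_objectI_Ker[OF I] by simp
  then have "m = ZeroArr A I ?Y" using A.Ident_Zero_imp[OF _ m(1)] A.zero_object_iff by simp
  then show "h = ZeroArr A X ?Y"
    using me A.Zero_Comp[OF e(1) A.homset_Obj(2)[OF m(1)]] by simp
qed

section \<open>Epibricks and monobricks in the middle category\<close>

lemma intermediate_section_j_dnx: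
  "(\<And>f. mono_arr A f \<Longrightarrow> mono_arr A' (FArr i_ups f)) \<Longrightarrow> intermediate_section A A'' j_ups j_dnx"
  by (simp add: intermediate_section_def j_dnx.FObj_Obj isomorphic_j_ups_j_dnx
      faithful_from_j_dnx faithful_to_j_dnx)

lemma intermediate_section_j_dns:
  "(\<And>f. epi_arr A f \<Longrightarrow> epi_arr A' (FArr i_upx f)) \<Longrightarrow> intermediate_section A A'' j_ups j_dns"
  using recollement.intermediate_section_j_dnx[OF recollement_op_cat]
  by (simp add: intermediate_section_op_cat)

text \<open>Pairs of representatives fall into four cases: full faithfulness of \<open>i_dns\<close>
  settles one, mixed arrows vanish, and between values of \<open>G\<close> everything is reflected
  from \<open>A''\<close> by \<open>j_ups\<close>. Leaving \<open>G\<close> general covers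
  \<open>j_dnx\<close>, \<open>j_dns\<close> and the intermediate extension at once.\<close>

lemma epibrick_union:
  assumes G: "intermediate_section A A'' j_ups G" and C': "epibrick A' C'" and C'': "epibrick A'' C''"
  shows "epibrick A (ftr_image A i_dns C' \<union> ftr_image A G C'')"
proof -
  note i_dns_ff = fully_faithful_epibrick[OF preadditive(1,2) additive(2) full_faithful(1)
      i_dns_preserves_epi C']
  have GM: "FObj G M \<in> Obj A" "isomorphic A'' M (FObj j_ups (FObj G M))"
    "faithful_from A A'' j_ups (FObj G M)" "faithful_to A A'' j_ups (FObj G M)"
    if "M \<in> \<Union>C''" for M
    using G A''.epibrickD(2)[OF C'' that] by (simp_all add: intermediate_section_def)
  let ?T = "FObj i_dns ` \<Union>C' \<union> FObj G ` \<Union>C''"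
  have "epibrick A ((\<lambda>X. {Y. isomorphic A X Y}) ` ?T)"
  proof (rule A.epibrick_iso_classes)
    fix X assume "X \<in> ?T"
    then consider B where "B \<in> \<Union>C'" "X = FObj i_dns B" | M where "M \<in> \<Union>C''" "X = FObj G M" by blast
    then show "brick A X"
    proof cases
      case 1
      then show ?thesis using i_dns_ff(1) by simp
    next
      case 2
      have "brick A'' (FObj j_ups X)"
        using A''.brick_isomorphic[OF GM(2)[OF 2(1)] A''.epibrickD(1)[OF C'' 2(1)]] 2(2) by simp
      then show ?thesis
        using faithful_brick[OF abelian(2) preadditive(3) additive(5)] GM[OF 2(1)] 2(2) by simp
    qed
  next
    fix X Y assume "X \<in> ?T" "Y \<in> ?T"
    then consider (ii) B B' where "B \<in> \<Union>C'" "X = FObj i_dns B" "B' \<in> \<Union>C'" "Y = FObj i_dns B'"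
      | (ij) B M where "B \<in> \<Union>C'" "X = FObj i_dns B" "M \<in> \<Union>C''" "Y = FObj G M"
      | (ji) M B where "M \<in> \<Union>C''" "X = FObj G M" "B \<in> \<Union>C'" "Y = FObj i_dns B"
      | (jj) M N where "M \<in> \<Union>C''" "X = FObj G M" "N \<in> \<Union>C''" "Y = FObj G N" by blast
    then show "epi_or_zero A X Y"
    proof cases
      case ii
      then show ?thesis using i_dns_ff(2) by simp
    next
      case ij
      then show ?thesis
        using hom_from_i_dns_zero[OF GM(4)[OF ij(3)] A'.epibrickD(2)[OF C' ij(1)]]
        by (simp add: epi_or_zero_def)
    next
      case ji
      then show ?thesis
        using hom_to_i_dns_zero[OF GM(3)[OF ji(1)] A'.epibrickD(2)[OF C' ji(3)]]
        by (simp add: epi_or_zero_def)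
    next
      case jj
      have "epi_or_zero A'' (FObj j_ups X) (FObj j_ups Y)"
        using A''.epi_or_zero_isomorphic[OF GM(2)[OF jj(1)] GM(2)[OF jj(3)]
            A''.epibrickD(3)[OF C'' jj(1,3)]] jj by simp
      then show ?thesis
        using faithful_from_epi_or_zero[OF j_ups_additive] GM(3) jj by simp
    qed
  qed
  then show ?thesis by (simp add: ftr_image_eq image_Un)
qed

lemma monobrick_union:
  "\<lbrakk>intermediate_section A A'' j_ups G; monobrick A' C'; monobrick A'' C''\<rbrakk>
    \<Longrightarrow> monobrick A (ftr_image A i_dns C' \<union> ftr_image A G C'')"
  using recollement.epibrick_union[OF recollement_op_cat, of G C' C'']
  by (simp add: intermediate_section_op_cat ftr_image_op_cat A'.epibrick_op_cat A.epibrick_op_cat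
      A''.epibrick_op_cat)

lemma j_dnx_epibrick:
  assumes "epibrick A'' S"
  shows "epibrick A (ftr_image A j_dnx S)"
  unfolding ftr_image_eq
  using fully_faithful_epibrick[OF preadditive(3,2) additive(4) full_faithful(2)
      j_dnx_preserves_epi assms]
  by (intro A.epibrick_iso_classes) auto

lemma j_dns_monobrick: "monobrick A'' S \<Longrightarrow> monobrick A (ftr_image A j_dns S)"
  using recollement.j_dnx_epibrick[OF recollement_op_cat, of S]
  by (simp add: ftr_image_op_cat A.epibrick_op_cat A''.epibrick_op_cat)

text \<open>The image of \<gamma> at \<open>M\<close> is a quotient of \<open>FObj j_dnx M\<close>
  and a subobject of \<open>FObj j_dns M\<close>, which gives faithfulness on both sides. Since
  \<open>j_ups\<close> turns \<gamma> into an isomorphism, it sends the image back to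
  \<open>M\<close>.\<close>

lemma intermediate_section_intermediate_extension:
  assumes \<phi>: "adjunction A'' A j_dnx j_ups \<phi>" and \<psi>: "adjunction A A'' j_ups j_dns \<psi>"
  shows "intermediate_section A A'' j_ups (intermediate_extension A A'' j_dnx j_ups j_dns \<phi> \<psi>)"
  unfolding intermediate_section_def
proof
  interpret \<phi>: additive_adjunction A'' A j_dnx j_ups \<phi>
    by (intro additive_adjunction.intro additive_adjunction_axioms.intro preadditive additive \<phi>)
  interpret \<psi>: additive_adjunction A A'' j_ups j_dns \<psi>
    by (intro additive_adjunction.intro additive_adjunction_axioms.intro preadditive additive \<psi>)
  fix M assume M: "M \<in> Obj A''"
  let ?L = "FObj j_dnx M" and ?R = "FObj j_dns M"
  let ?\<epsilon> = "counit A'' A j_ups j_dns \<psi> M"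
  have L: "?L \<in> Obj A" and R: "?R \<in> Obj A" using j_dnx.FObj_Obj[OF M] j_dns.FObj_Obj[OF M] .
  have \<epsilon>: "?\<epsilon> \<in> homset A'' (FObj j_ups ?R) M" using \<psi>.counit_iso(1)[OF full_faithful(3) M] .
  obtain s where s: "s \<in> homset A'' M (FObj j_ups ?R)" "?\<epsilon> \<cdot>\<^bsub>A''\<^esub> s = Ident A'' M"
    "s \<cdot>\<^bsub>A''\<^esub> ?\<epsilon> = Ident A'' (FObj j_ups ?R)"
    using \<psi>.counit_iso(2)[OF full_faithful(3) M] by blast
  \<comment> \<open>The defining equation of \<gamma> says that its transpose is inverse to the
    counit, so \<gamma> is the arrow with transpose \<open>s\<close>.\<close>
  obtain g where g: "g \<in> homset A ?L ?R" "\<phi> M ?R g = s" using \<phi>.transpose_surj[OF R s(1)] by blast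
  have gamma: "gamma A A'' j_dnx j_ups j_dns \<phi> \<psi> M = g"
    unfolding gamma_def
  proof (rule the_equality)
    fix k assume k: "k \<in> homset A ?L ?R \<and> ?\<epsilon> \<cdot>\<^bsub>A''\<^esub> \<phi> M ?R k = Ident A'' M"
    then have "\<phi> M ?R k = s \<cdot>\<^bsub>A''\<^esub> (?\<epsilon> \<cdot>\<^bsub>A''\<^esub> \<phi> M ?R k)"
      using A''.retract_cancel[OF \<phi>.transpose_hom[OF M] \<epsilon> s(1,3), of k] by simp
    also have "\<dots> = s" using k A''.Comp_Ident[OF s(1)] by simp
    finally show "k = g" using \<phi>.transpose_inj[OF M _ g(1), of k] k g(2) by simp
  qed (use g s in simp)
  define m where "m = im_incl A g"
  have "is_image A g m"
    unfolding m_def im_incl_def by (rule someI_ex[OF A.ex_image[OF homset_Arr[OF g(1)]]])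
  then obtain I e where e: "e \<in> homset A ?L I" "epi_arr A e" and m: "m \<in> homset A I ?R" "mono_arr A m"
    and me: "m \<cdot>\<^bsub>A\<^esub> e = g"
    by (rule A.image_factorization[OF g(1)])
  have "FObj (intermediate_extension A A'' j_dnx j_ups j_dns \<phi> \<psi>) M = I"
    using gamma homset_Dom[OF m(1)] by (simp add: intermediate_extension_def Let_def im_obj_def m_def)
  moreover have "I \<in> Obj A" using A.homset_Obj(1)[OF m(1)] .
  moreover have "faithful_from A A'' j_ups I"
    using faithful_from_epi[OF j_ups_additive faithful_from_j_dnx[OF M] e] .
  moreover have "faithful_to A A'' j_ups I"
    using faithful_to_mono[OF j_ups_additive faithful_to_j_dns[OF M] m] .
  moreover have "isomorphic A'' M (FObj j_ups I)"
  proof -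
    note je = j_ups.FArr_hom[OF e(1)] and jm = j_ups.FArr_hom[OF m(1)] and \<eta> = \<phi>.unit_hom[OF M]
    obtain r where r: "r \<in> homset A'' (FObj j_ups ?L) M"
      "\<phi>.unit M \<cdot>\<^bsub>A''\<^esub> r = Ident A'' (FObj j_ups ?L)"
      using \<phi>.fully_faithful_unit[OF full_faithful(2) M] by blast
    \<comment> \<open>The candidate isomorphism from \<open>M\<close>: epic, as the unit is split
      epic and \<open>j_ups\<close> preserves \<open>e\<close>, and split monic, with retraction the
      counit after \<open>FArr j_ups m\<close>.\<close>
    let ?k = "FArr j_ups e \<cdot>\<^bsub>A''\<^esub> \<phi>.unit M"
    have k: "?k \<in> homset A'' M (FObj j_ups I)" using A''.Comp_hom[OF \<eta> je] .
    have epi: "epi_arr A'' ?k"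
      using A''.epi_arr_Comp[OF A''.split_epi_arr[OF \<eta> r] j_ups_preserves_epi[OF e(2)] \<eta> je] .
    have "(?\<epsilon> \<cdot>\<^bsub>A''\<^esub> FArr j_ups m) \<cdot>\<^bsub>A''\<^esub> ?k = ?\<epsilon> \<cdot>\<^bsub>A''\<^esub> (FArr j_ups m \<cdot>\<^bsub>A''\<^esub> ?k)"
      using A''.Comp_assoc[OF k jm \<epsilon>] .
    also have "FArr j_ups m \<cdot>\<^bsub>A''\<^esub> ?k = FArr j_ups g \<cdot>\<^bsub>A''\<^esub> \<phi>.unit M"
      using A''.Comp_assoc[OF \<eta> je jm] j_ups.FArr_Comp[OF e(1) m(1)] me by simp
    also have "\<dots> = s" using \<phi>.transpose_eq_unit[OF M g(1)] g(2) by simp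
    finally have "(?\<epsilon> \<cdot>\<^bsub>A''\<^esub> FArr j_ups m) \<cdot>\<^bsub>A''\<^esub> ?k = Ident A'' M" using s(2) by simp
    then have "mono_arr A'' ?k" by (rule A''.split_mono_arr[OF k A''.Comp_hom[OF jm \<epsilon>]])
    then show ?thesis
      using A''.mono_epi_imp_iso[OF k _ epi] k A''.homset_Obj[OF k] unfolding isomorphic_def by blast
  qed
  ultimately show "FObj (intermediate_extension A A'' j_dnx j_ups j_dns \<phi> \<psi>) M \<in> Obj A \<and>
      isomorphic A'' M (FObj j_ups (FObj (intermediate_extension A A'' j_dnx j_ups j_dns \<phi> \<psi>) M)) \<and>
      faithful_from A A'' j_ups (FObj (intermediate_extension A A'' j_dnx j_ups j_dns \<phi> \<psi>) M) \<and>
      faithful_to A A'' j_ups (FObj (intermediate_extension A A'' j_dnx j_ups j_dns \<phi> \<psi>) M)"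
    by simp
qed

end

theorem theorem1p2:
  fixes A' :: "('o1, 'm1) preadd_cat"
    and A :: "('o, 'm) preadd_cat"
    and A'' :: "('o2, 'm2) preadd_cat"
    and i_ups :: "('o, 'm, 'o1, 'm1) ftr"
    and i_dns :: "('o1, 'm1, 'o, 'm) ftr"
    and i_upx :: "('o, 'm, 'o1, 'm1) ftr"
    and j_dnx :: "('o2, 'm2, 'o, 'm) ftr"
    and j_ups :: "('o, 'm, 'o2, 'm2) ftr"
    and j_dns :: "('o2, 'm2, 'o, 'm) ftr"
    and \<phi> :: "'o2 \<Rightarrow> 'o \<Rightarrow> 'm \<Rightarrow> 'm2"
    and \<psi> :: "'o \<Rightarrow> 'o2 \<Rightarrow> 'm2 \<Rightarrow> 'm"
    and j_dnxs :: "('o2, 'm2, 'o, 'm) ftr"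
  assumes "recollement A' A A'' i_ups i_dns i_upx j_dnx j_ups j_dns"
    and "adjunction A'' A j_dnx j_ups \<phi>"
    and "adjunction A A'' j_ups j_dns \<psi>"
    and "j_dnxs = intermediate_extension A A'' j_dnx j_ups j_dns \<phi> \<psi>"
  shows
    "((\<forall>S. epibrick A' S \<longrightarrow> epibrick A (ftr_image A i_dns S)) \<and>
      (\<forall>S. monobrick A' S \<longrightarrow> monobrick A (ftr_image A i_dns S)) \<and>
      (\<forall>S. epibrick A'' S \<longrightarrow> epibrick A (ftr_image A j_dnxs S)) \<and>
      (\<forall>S. monobrick A'' S \<longrightarrow> monobrick A (ftr_image A j_dnxs S))) \<and>
     ((\<forall>S. monobrick A'' S \<longrightarrow> monobrick A (ftr_image A j_dns S)) \<and>
      (\<forall>S. epibrick A'' S \<longrightarrow> epibrick A (ftr_image A j_dnx S))) \<and>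
     ((\<forall>C' C''. epibrick A' C' \<and> epibrick A'' C'' \<longrightarrow>
        epibrick A (ftr_image A i_dns C' \<union> ftr_image A j_dnxs C'')) \<and>
      (\<forall>C' C''. monobrick A' C' \<and> monobrick A'' C'' \<longrightarrow>
        monobrick A (ftr_image A i_dns C' \<union> ftr_image A j_dnxs C''))) \<and>
     ((\<forall>C' C''. epibrick A' C' \<and> epibrick A'' C'' \<longrightarrow>
        (exact_functor A A' i_ups \<longrightarrow>
          epibrick A (ftr_image A i_dns C' \<union> ftr_image A j_dnx C'')) \<and>
        (exact_functor A A' i_upx \<longrightarrow>
          epibrick A (ftr_image A i_dns C' \<union> ftr_image A j_dns C''))) \<and>
      (\<forall>C' C''. monobrick A' C' \<and> monobrick A'' C'' \<longrightarrow>
        (exact_functor A A' i_ups \<longrightarrow>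
          monobrick A (ftr_image A i_dns C' \<union> ftr_image A j_dnx C'')) \<and>
        (exact_functor A A' i_upx \<longrightarrow>
          monobrick A (ftr_image A i_dns C' \<union> ftr_image A j_dns C''))))"
proof -
  interpret recollement A' A A'' i_ups i_dns i_upx j_dnx j_ups j_dns by (rule assms(1))
  have j_dnxs: "intermediate_section A A'' j_ups j_dnxs"
    using intermediate_section_intermediate_extension[OF assms(2,3)] assms(4) by simp
  \<comment> \<open>Exactness of \<open>i_ups\<close> enters through monomorphisms, that of
    \<open>i_upx\<close> through epimorphisms.\<close>
  have j_dnx: "intermediate_section A A'' j_ups j_dnx" if "exact_functor A A' i_ups"
    using intermediate_section_j_dnx exact_functor_mono[OF abelian(2) that] by simp
  have j_dns: "intermediate_section A A'' j_ups j_dns" if "exact_functor A A' i_upx"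
    using intermediate_section_j_dns exact_functor_epi[OF abelian(2) that] by simp
  \<comment> \<open>Taking one family empty in the union results yields the claims for
    \<open>i_dns\<close> and \<open>j_dnxs\<close> alone.\<close>
  have empty: "epibrick A' {}" "epibrick A'' {}" "monobrick A' {}" "monobrick A'' {}"
    by (simp_all add: epibrick_def monobrick_def)
  have "epibrick A (ftr_image A i_dns S)" if "epibrick A' S" for S
    using epibrick_union[OF j_dnxs that empty(2)] by (simp add: ftr_image_def)
  moreover have "monobrick A (ftr_image A i_dns S)" if "monobrick A' S" for S
    using monobrick_union[OF j_dnxs that empty(4)] by (simp add: ftr_image_def)
  moreover have "epibrick A (ftr_image A j_dnxs S)" if "epibrick A'' S" for S
    using epibrick_union[OF j_dnxs empty(1) that] by (simp add: ftr_image_def)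
  moreover have "monobrick A (ftr_image A j_dnxs S)" if "monobrick A'' S" for S
    using monobrick_union[OF j_dnxs empty(3) that] by (simp add: ftr_image_def)
  ultimately show ?thesis
    using j_dns_monobrick j_dnx_epibrick epibrick_union[OF j_dnxs] monobrick_union[OF j_dnxs]
      epibrick_union[OF j_dnx] monobrick_union[OF j_dnx]
      epibrick_union[OF j_dns] monobrick_union[OF j_dns]
    by simp
qed

end
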